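(* Let $S\ge 1$ and $p\ge 1$ be integers and let $\{Z_t,t\in\mathbb{Z}\}$ be the (periodically stationary) process defined by $$\phi_t(L)Z_t=(1-L^S)^{-D_t}u_t,\qquad t\in\mathbb{Z},$$ in the setting described in the context, in particular with $0\le D_s<\tfrac12$ for $s=1,\dots,S$ and with the stated root condition on the autoregressive part. Let $D_{\max}=\max_{1\le s\le S}D_s$ and $F_1=\{i\in\{1,\dots,S\}: D_i=D_{\max}\}$. Let $\gamma^{(s)}(j)=\mathrm{Cov}(Z_{S\tau+s},Z_{S\tau+s+j})$ for $s\in\{1,\dots,S\}$ and integers $j>0$. Write $j=hS+\nu$ with integers $h\ge 0$ and $0\le\nu\le S-1$, and put $\delta=0$ if $1\le s+\nu\le S$ and $\delta=1$ if $S+1\le s+\nu\le 2S-1$. Then, for every fixed $s\in\{1,\dots,S\}$ and $\nu\in\{0,\dots,S-1\}$, as $h\to\infty$ (that is, as $j=hS+\nu\to\infty$), $$\gamma^{(s)}(j)\sim (h+\delta)^{2D_{\max}-1}\left[\frac{\Gamma(1-2D_{\max})}{\Gamma(D_{\max})\,\Gamma(1-D_{\max})}\right]\sum_{i\in F_1}\mathbf{\Pi}(s,i)\,\mathbf{\Pi}(s+\nu-S\delta,i)\,\sigma_i^2,$$ where $\mathbf{\Pi}(l,i)$ is the $(l,i)$-th element of the matrix $\mathbf{\Pi}=[\mathbf{\Phi}(1)]^{-1}=\sum_{j\ge0}\mathbf{\Pi}_j$.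
   Context: $L$ is the lag operator, $LX_t=X_{t-1}$. $\{u_t,t\in\mathbb{Z}\}$ is a zero-mean white noise (pairwise uncorrelated variables) with variance $\mathrm{Var}(u_t)=\sigma_t^2$, where $\sigma_{t+S}^2=\sigma_t^2$. The fractional parameter $D_t\in\mathbb{R}$ is $S$-periodic in $t$. $\phi_t(L)=1-\phi_{t,1}L-\dots-\phi_{t,p}L^p$ with real coefficients $\phi_{t,i}$ that are $S$-periodic in $t$; set $\phi_{t,i}=0$ for $i>p$. The operator $(1-L^S)^{-D_t}$ is defined by $(1-L^S)^{-D_t}u_t=\sum_{j\ge0}\frac{\Gamma(j+D_t)}{\Gamma(j+1)\Gamma(D_t)}u_{t-Sj}$ (the identity if $D_t=0$). $S$-variate form: put $\underline{\mathbf{Z}}_\tau=(Z_{1+S\tau},\dots,Z_{S+S\tau})'$ and $\underline{\mathbf{u}}_\tau=(u_{1+S\tau},\dots,u_{S+S\tau})'$, and let $L$ act on $\tau$ in these vectors. The model reads $\mathbf{\Phi}(L)\,\underline{\mathbf{Z}}_\tau=\nabla^{-\underline{\mathbf D}}(L)\,\underline{\mathbf{u}}_\tau$, where $\nabla^{-\underline{\mathbf D}}(L)=\mathrm{diag}((1-L)^{-D_1},\dots,(1-L)^{-D_S})$ with $(1-L)^{-D}=\sum_{j\ge0}\frac{\Gamma(j+D)}{\Gamma(j+1)\Gamma(D)}L^j$ (the identity if $D=0$), $\mathbf{\Phi}(L)=\mathbf{\Phi}_0-\mathbf{\Phi}_1L-\dots-\mathbf{\Phi}_{\mathbf P}L^{\mathbf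 P}$, $\mathbf P=\lfloor (p+1)/S\rfloor+1$, and the $S\times S$ matrices are: $(\mathbf{\Phi}_0)_{s,k}=1$ if $s=k$, $0$ if $s<k$, $-\phi_{s,s-k}$ if $s>k$; and $(\mathbf{\Phi}_i)_{s,k}=\phi_{s,\,iS+s-k}$ for $1\le i\le\mathbf P$, $1\le s,k\le S$. Stationarity assumptions: all roots $z$ of $\det\big(I_Sz^{\mathbf P}-\sum_{i=1}^{\mathbf P}\mathbf{\Phi}_0^{-1}\mathbf{\Phi}_iz^{\mathbf P-i}\big)=0$ satisfy $|z|<1$, and $0\le D_s<\tfrac12$ for all $s=1,\dots,S$. Then $\mathbf{\Phi}(L)^{-1}=\sum_{j\ge0}\mathbf{\Pi}_jL^j$ with entrywise absolutely summable coefficient matrices, and $\underline{\mathbf{Z}}_\tau$ is the stationary solution given by the mean-square convergent infinite moving average $\underline{\mathbf{Z}}_\tau=\mathbf{\Phi}(L)^{-1}\nabla^{-\underline{\mathbf D}}(L)\underline{\mathbf{u}}_\tau$. Conventions: $1/\Gamma(0)=0$. The relation $a_h\sim (h+\delta)^{\alpha}c$ means $a_h/(h+\delta)^{\alpha}\to c$ as $h\to\infty$ (so that it is meaningful also when the constant $c$ is $0$). *)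

theory Defs
  imports
    "HOL-Probability.Probability"
    "Jordan_Normal_Form.Determinant"
    "Jordan_Normal_Form.Gauss_Jordan_Elimination"
begin

definition square_integrable :: "'a measure \<Rightarrow> ('a \<Rightarrow> real) \<Rightarrow> bool" where
  "square_integrable M X \<longleftrightarrow>
     X \<in> borel_measurable M \<and> integrable M (\<lambda>\<omega>. (X \<omega>)\<^sup>2)"

definition covariance :: "'a measure \<Rightarrow> ('a \<Rightarrow> real) \<Rightarrow> ('a \<Rightarrow> real) \<Rightarrow> real" where
  "covariance M X Y =
     (LINT \<omega>|M. (X \<omega> - (LINT x|M. X x)) * (Y \<omega> - (LINT x|M. Y x)))"

(* Square integrability is required explicitly because the Bochner integral of a
   non-integrable function is 0. *)
definition ms_sums :: "'a measure \<Rightarrow> (nat \<Rightarrow> 'a \<Rightarrow> real) \<Rightarrow> ('a \<Rightarrow> real) \<Rightarrow> bool" where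
  "ms_sums M X Y \<longleftrightarrow>
     (\<forall>j. square_integrable M (X j)) \<and> square_integrable M Y \<and>
     (\<lambda>n. LINT \<omega>|M. ((\<Sum>j<n. X j \<omega>) - Y \<omega>)\<^sup>2) \<longlonglongrightarrow> 0"

definition periodic :: "nat \<Rightarrow> (int \<Rightarrow> 'b) \<Rightarrow> bool" where
  "periodic S f \<longleftrightarrow> (\<forall>t. f (t + int S) = f t)"

(* The variances are allowed to depend on time. *)
definition white_noise :: "'a measure \<Rightarrow> (int \<Rightarrow> 'a \<Rightarrow> real) \<Rightarrow> (int \<Rightarrow> real) \<Rightarrow> bool" where
  "white_noise M u \<sigma> \<longleftrightarrow>
     (\<forall>t. square_integrable M (u t)) \<and>
     (\<forall>t. (LINT \<omega>|M. u t \<omega>) = 0) \<and>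
     (\<forall>t. covariance M (u t) (u t) = (\<sigma> t)\<^sup>2) \<and>
     (\<forall>t r. t \<noteq> r \<longrightarrow> covariance M (u t) (u r) = 0)"

definition periodically_stationary :: "'a measure \<Rightarrow> nat \<Rightarrow> (int \<Rightarrow> 'a \<Rightarrow> real) \<Rightarrow> bool" where
  "periodically_stationary M S Z \<longleftrightarrow>
     (\<forall>t. square_integrable M (Z t)) \<and>
     (\<forall>t. (LINT \<omega>|M. Z (t + int S) \<omega>) = (LINT \<omega>|M. Z t \<omega>)) \<and>
     (\<forall>t r. covariance M (Z (t + int S)) (Z (r + int S)) = covariance M (Z t) (Z r))"

(* Coefficients of the power series (1 - x) powr (-D).  The Gamma quotient is not usable
   for D = 0, since Gamma 0 = 0. *)
definition frac_coeff :: "real \<Rightarrow> nat \<Rightarrow> real" where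
  "frac_coeff D j =
     (if D = 0 then (if j = 0 then 1 else 0)
      else Gamma (real j + D) / (Gamma (real j + 1) * Gamma D))"

(* phi_t(L) Z_t = (1 - L^S)^(-D_t) u_t: the mean-square limit of the series on the right
   is the random variable on the left. *)
definition pfar_equation ::
  "'a measure \<Rightarrow> nat \<Rightarrow> nat \<Rightarrow> (int \<Rightarrow> nat \<Rightarrow> real) \<Rightarrow> (int \<Rightarrow> real) \<Rightarrow>
   (int \<Rightarrow> 'a \<Rightarrow> real) \<Rightarrow> (int \<Rightarrow> 'a \<Rightarrow> real) \<Rightarrow> bool" where
  "pfar_equation M S p \<phi> D u Z \<longleftrightarrow>
     (\<forall>t. ms_sums M (\<lambda>j \<omega>. frac_coeff (D t) j * u (t - int S * int j) \<omega>)
                    (\<lambda>\<omega>. Z t \<omega> - (\<Sum>i=1..p. \<phi> t i * Z (t - int i) \<omega>)))"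

(* Matrices of the S-variate form.  Matrix indices start at 0, so that entry (s, k)
   belongs to the seasons s + 1 and k + 1. *)

definition P_order :: "nat \<Rightarrow> nat \<Rightarrow> nat" where
  "P_order S p = (p + 1) div S + 1"

definition Phi0 :: "nat \<Rightarrow> (int \<Rightarrow> nat \<Rightarrow> real) \<Rightarrow> real mat" where
  "Phi0 S \<phi> = Matrix.mat S S (\<lambda>(s, k).
     if s = k then 1 else if s < k then 0 else - \<phi> (int (s + 1)) (s - k))"

definition Phi :: "nat \<Rightarrow> (int \<Rightarrow> nat \<Rightarrow> real) \<Rightarrow> nat \<Rightarrow> real mat" where
  "Phi S \<phi> i = Matrix.mat S S (\<lambda>(s, k). \<phi> (int (s + 1)) (i * S + s - k))"

(* The coefficient of L^n in the matrix polynomial Phi(L). *)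
definition Phi_coeff :: "nat \<Rightarrow> nat \<Rightarrow> (int \<Rightarrow> nat \<Rightarrow> real) \<Rightarrow> nat \<Rightarrow> real mat" where
  "Phi_coeff S p \<phi> n =
     (if n = 0 then Phi0 S \<phi> else if n \<le> P_order S p then - Phi S \<phi> n else 0\<^sub>m S S)"

(* The value Phi(1). *)
definition Phi_one :: "nat \<Rightarrow> nat \<Rightarrow> (int \<Rightarrow> nat \<Rightarrow> real) \<Rightarrow> real mat" where
  "Phi_one S p \<phi> = Matrix.mat S S (\<lambda>(s, k).
     Phi0 S \<phi> $$ (s, k) - (\<Sum>i=1..P_order S p. Phi S \<phi> i $$ (s, k)))"

(* Meaningful for invertible square matrices only. *)
definition inv_mat :: "real mat \<Rightarrow> real mat" where
  "inv_mat A = the (mat_inverse A)"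

(* I z^P - (sum i=1..P. Phi0^(-1) Phi_i z^(P-i)).  Phi0 is invertible, being lower
   triangular with unit diagonal. *)
definition char_mat :: "nat \<Rightarrow> nat \<Rightarrow> (int \<Rightarrow> nat \<Rightarrow> real) \<Rightarrow> complex \<Rightarrow> complex mat" where
  "char_mat S p \<phi> z = Matrix.mat S S (\<lambda>(s, k).
     (if s = k then z ^ P_order S p else 0) -
     (\<Sum>i=1..P_order S p.
        complex_of_real ((inv_mat (Phi0 S \<phi>) * Phi S \<phi> i) $$ (s, k)) * z ^ (P_order S p - i)))"

(* Phi(L) * (sum j. Pc j * L^j) = I as formal power series in L, i.e. the Pc j are the
   coefficients of the inverse of Phi(L).  Since Phi0 is invertible, exactly one sequence
   Pc satisfies this. *)
definition Phi_inverse_coeffs ::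
  "nat \<Rightarrow> nat \<Rightarrow> (int \<Rightarrow> nat \<Rightarrow> real) \<Rightarrow> (nat \<Rightarrow> real mat) \<Rightarrow> bool" where
  "Phi_inverse_coeffs S p \<phi> Pc \<longleftrightarrow>
     (\<forall>j. Pc j \<in> carrier_mat S S) \<and>
     (\<forall>n s k. s < S \<longrightarrow> k < S \<longrightarrow>
        (\<Sum>i\<le>n. (Phi_coeff S p \<phi> i * Pc (n - i)) $$ (s, k)) = (if n = 0 \<and> s = k then 1 else 0))"

end

theory Submission
  imports
    Defs
    "HOL-Complex_Analysis.Cauchy_Integral_Formula"
    "HOL-Real_Asymp.Real_Asymp"
begin

text \<open>
  Put \<open>W t = Z t - (\<Sum>i=1..p. \<phi> t i * Z (t - i))\<close>, the fractionally integrated noise that drives the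
  autoregression.  For a square-integrable \<open>Y\<close> the sequence \<open>t \<mapsto> covariance M (Z t) Y\<close> is bounded, and
  the autoregressive filter turns it into \<open>t \<mapsto> covariance M (W t) Y\<close>.  Inverting the filter on
  bounded sequences of numbers is therefore enough, and no moving average representation of \<open>Z\<close> itself
  has to be constructed.  Inverting once with \<open>Y = Z t'\<close> and once more with \<open>Y = W t\<close> gives, for seasons
  \<open>s\<close>, \<open>r\<close> and a lag of \<open>H\<close> periods,
  \<open>cov = (\<Sum>l<S. \<Sum>n. \<Sum>m. Pc n (s, l) * Pc m (r, l) * g l \<bar>H + n - m\<bar>)\<close>,
  where \<open>g l\<close> is the autocovariance of the noise in season \<open>l\<close>; different seasons of \<open>W\<close> are
  uncorrelated, because they are built from disjoint sets of innovations.

  Two estimates carry the limit.  First, the autocovariances of fractional noise are known exactly: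
  they are a hypergeometric series at \<open>1\<close>, which Gauss's theorem (\<open>gauss_summation\<close>) evaluates, and
  Euler's product for the Gamma function yields \<open>g l h ~ const * h powr (2 * d l - 1)\<close>
  (\<open>frac_acv_asymp\<close>).  Second, the root condition says that \<open>det \<Phi>(z)\<close> has no zero in the closed unit disc,
  hence none in a slightly larger one, so that \<open>\<Phi>(z)^(-1) = adj \<Phi>(z) / det \<Phi>(z)\<close> has radius of convergence
  above \<open>1\<close> and \<open>\<Sum>n. (1 + n) * \<bar>Pc n (s, l)\<bar>\<close> converges (\<open>inverse_coeffs_summable\<close>).  This weight is
  enough to dominate the normalised double series, because
  \<open>1 + H \<le> (1 + \<bar>H + n - m\<bar>) * (1 + n) * (1 + m)\<close>.  Tannery's theorem, applied to both sums
  (\<open>filtered_acv_asymp\<close>), then replaces every \<open>g l \<bar>H + n - m\<bar>\<close> by its limit and leaves the product of the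
  sums \<open>\<Sum>n. Pc n (s, l)\<close> and \<open>\<Sum>m. Pc m (r, l)\<close>, which are entries of \<open>\<Phi>(1)^(-1)\<close>.  Seasons with
  \<open>d l < D_max\<close> contribute a lower order and disappear.
\<close>

section \<open>Gauss's summation theorem\<close>

text \<open>
  The terms of the hypergeometric series \<open>F(a, b; c; 1)\<close>.
\<close>
definition hypergeo_term :: "real \<Rightarrow> real \<Rightarrow> real \<Rightarrow> nat \<Rightarrow> real" where
  "hypergeo_term a b c k = pochhammer a k * pochhammer b k / (pochhammer c k * fact k)"

lemma hypergeo_term_Suc:
  assumes "c > 0"
  shows "hypergeo_term a b c (Suc k) =
    hypergeo_term a b c k * ((a + real k) * (b + real k) / ((c + real k) * real (Suc k)))"
  by (simp add: hypergeo_term_def pochhammer_Suc field_simps)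

text \<open>
  Euler's product in the form \<open>rGamma_series z n \<longlonglongrightarrow> rGamma z\<close> measures a Pochhammer symbol
  against \<open>fact n * n powr z\<close>, so this identity shows the terms to be of order
  \<open>k powr (a + b - c - 1)\<close>.
\<close>
lemma hypergeo_term_asymp:
  "real (Suc n) * hypergeo_term a b c (Suc n) =
    rGamma_series a n * rGamma_series b n / rGamma_series c n * exp ((a + b - c) * ln (real n))"
proof -
  have "exp ((a + b - c) * ln (real n)) =
      exp (a * ln (real n)) * exp (b * ln (real n)) / exp (c * ln (real n))"
    by (simp add: exp_add [symmetric] exp_diff [symmetric] algebra_simps)
  then show ?thesis
    unfolding rGamma_series_def hypergeo_term_def
    by (simp add: fact_Suc del: of_nat_Suc)
qed

lemma hypergeo_term_limits:
  assumes "c > 0" "c > a + b"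
  shows "(\<lambda>k. real k * hypergeo_term a b c k) \<longlonglongrightarrow> 0"
    and "summable (hypergeo_term a b c)"
proof -
  define q where "q n = rGamma_series a n * rGamma_series b n / rGamma_series c n" for n
  have "rGamma c \<noteq> 0"
    using assms by (simp add: rGamma_eq_zero_iff) (metis nonpos_Ints_nonpos not_le)
  then have q: "q \<longlonglongrightarrow> rGamma a * rGamma b / rGamma c"
    unfolding q_def by (intro tendsto_intros)
  have "((\<lambda>n. exp ((a + b - c) * ln (real n))) \<longlongrightarrow> 0) sequentially"
    using assms
    by (intro filterlim_compose [OF exp_at_bot] filterlim_tendsto_neg_mult_at_bot [OF tendsto_const]
        filterlim_compose [OF ln_at_top] filterlim_real_sequentially) auto
  then have "(\<lambda>n. q n * exp ((a + b - c) * ln (real n))) \<longlonglongrightarrow> rGamma a * rGamma b / rGamma c * 0"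
    by (intro tendsto_mult q)
  then have "(\<lambda>n. real (Suc n) * hypergeo_term a b c (Suc n)) \<longlonglongrightarrow> 0"
    by (simp add: hypergeo_term_asymp q_def del: of_nat_Suc)
  then show "(\<lambda>k. real k * hypergeo_term a b c k) \<longlonglongrightarrow> 0"
    by (rule LIMSEQ_imp_Suc)
  obtain K where K: "\<And>n. \<bar>q n\<bar> \<le> K"
    using convergent_imp_Bseq [of q] q unfolding convergent_def Bseq_def by auto
  have "summable (\<lambda>n. K * real n powr (a + b - c - 1))"
    using assms by (intro summable_mult) (simp add: summable_real_powr_iff)
  then have "summable (\<lambda>n. hypergeo_term a b c (Suc n))"
  proof (rule summable_comparison_test_ev [rotated])
    show "\<forall>\<^sub>F n in sequentially. norm (hypergeo_term a b c (Suc n)) \<le> K * real n powr (a + b - c - 1)"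
      using eventually_gt_at_top [of 0]
    proof eventually_elim
      case (elim n)
      have "\<bar>hypergeo_term a b c (Suc n)\<bar> = \<bar>q n\<bar> * (exp ((a + b - c) * ln (real n)) / real (Suc n))"
        using arg_cong [OF hypergeo_term_asymp [of n a b c], of "\<lambda>x. \<bar>x\<bar> / real (Suc n)"]
        by (simp add: q_def abs_mult del: of_nat_Suc)
      also have "\<dots> \<le> K * (exp ((a + b - c) * ln (real n)) / real n)"
        using elim by (intro mult_mono K order_trans [OF abs_ge_zero K] divide_left_mono) auto
      also have "exp ((a + b - c) * ln (real n)) / real n = real n powr (a + b - c - 1)"
        using elim by (simp add: powr_diff [of _ _ 1]) (simp add: powr_def)
      finally show ?case by simp
    qed
  qed
  then show "summable (hypergeo_term a b c)"
    by (simp only: summable_Suc_iff)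
qed

text \<open>
  The difference of the two multiples of the terms is the increment of \<open>- c * k * t k\<close>, where \<open>t\<close> denotes the
  terms for \<open>c\<close>; so the sum telescopes, and the boundary term vanishes because \<open>c > a + b\<close>.
\<close>
lemma gauss_contiguous:
  assumes "c > 0" "c > a + b"
  shows "c * (c - a - b) * suminf (hypergeo_term a b c) =
    (c - a) * (c - b) * suminf (hypergeo_term a b (c + 1))"
proof -
  define t where "t = hypergeo_term a b c"
  (* Both sides are multiples of t k; the quotients t (k + 1) / t k and hypergeo_term a b (c + 1) k / t k
     are rational in k. *)
  have step: "c * (c - a - b) * t k - (c - a) * (c - b) * hypergeo_term a b (c + 1) k =
      - c * (real (Suc k) * t (Suc k)) - - c * (real k * t k)" for k
  proof -
    have nz: "c + real k \<noteq> 0" "real (Suc k) \<noteq> 0" using assms by auto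
    have "pochhammer c k > 0" using assms by (simp add: pochhammer_pos)
    moreover have "pochhammer (c + 1) k * c = pochhammer c k * (c + real k)"
      by (metis mult.commute pochhammer_rec pochhammer_rec')
    ultimately have "c + real k = pochhammer (c + 1) k * c / pochhammer c k"
      by (simp add: field_simps)
    then have "hypergeo_term a b (c + 1) k * (c + real k) = c * t k"
      using assms pochhammer_pos [of "c + 1" k]
      by (simp only: hypergeo_term_def t_def) (simp add: mult_ac)
    then have 1: "hypergeo_term a b (c + 1) k = c * t k / (c + real k)"
      using nz by (simp add: field_simps)
    have 2: "real (Suc k) * t (Suc k) = t k * ((a + real k) * (b + real k) / (c + real k))"
      using hypergeo_term_Suc [OF assms(1), of a b k] nz by (simp add: t_def del: of_nat_Suc)
    show ?thesis
      unfolding 1 2 using nz by (simp add: divide_simps) (simp add: algebra_simps)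
  qed
  have "(\<lambda>k. - c * (real k * t k)) \<longlonglongrightarrow> - c * 0"
    unfolding t_def by (intro tendsto_intros hypergeo_term_limits assms)
  from telescope_sums [OF this]
  have "(\<lambda>k. c * (c - a - b) * t k - (c - a) * (c - b) * hypergeo_term a b (c + 1) k) sums 0"
    by (simp add: step)
  moreover have "(\<lambda>k. c * (c - a - b) * t k - (c - a) * (c - b) * hypergeo_term a b (c + 1) k) sums
      (c * (c - a - b) * suminf t - (c - a) * (c - b) * suminf (hypergeo_term a b (c + 1)))"
    unfolding t_def using assms
    by (intro sums_diff sums_mult summable_sums hypergeo_term_limits) auto
  ultimately show ?thesis
    using sums_unique2 t_def by fastforce
qed

text \<open>
  For large \<open>c\<close> only the term \<open>k = 0\<close> survives; the series for the smallest parameter dominates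
  all others, since for nonnegative \<open>a\<close> and \<open>b\<close> the terms decrease in the third parameter.
\<close>
lemma hypergeo_suminf_tendsto_1:
  assumes "a \<ge> 0" "b \<ge> 0" "c > a + b"
  shows "(\<lambda>n. suminf (hypergeo_term a b (c + real n))) \<longlonglongrightarrow> 1"
proof -
  have c: "c > 0" using assms by linarith
  define B where "B k = (if k = 0 then 1 else 0 :: real)" for k :: nat
  have lim: "(\<lambda>n. hypergeo_term a b (c + real n) k) \<longlonglongrightarrow> B k" for k
  proof (cases k)
    case 0
    then show ?thesis by (simp add: hypergeo_term_def B_def)
  next
    case (Suc m)
    (* The first factor of the denominator already tends to infinity, and the others stay above those for c. *)
    have "filterlim (\<lambda>n. pochhammer (c + real n) k) at_top sequentially"
    proof (rule filterlim_at_top_mono [where f = "\<lambda>n. pochhammer c m * (c + real n)"])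
      show "filterlim (\<lambda>n. pochhammer c m * (c + real n)) at_top sequentially"
        using c by (intro filterlim_tendsto_pos_mult_at_top [OF tendsto_const]
            filterlim_tendsto_add_at_top [OF tendsto_const] filterlim_real_sequentially pochhammer_pos)
      show "\<forall>\<^sub>F n in sequentially. pochhammer c m * (c + real n) \<le> pochhammer (c + real n) k"
      proof (rule always_eventually, intro allI)
        fix n
        have "pochhammer c m \<le> pochhammer (c + real n + 1) m"
          unfolding pochhammer_prod using c by (intro prod_mono) auto
        then show "pochhammer c m * (c + real n) \<le> pochhammer (c + real n) k"
          using c by (simp add: Suc pochhammer_rec mult.commute mult_right_mono)
      qed
    qed
    then have "(\<lambda>n. (pochhammer a k * pochhammer b k / fact k) / pochhammer (c + real n) k) \<longlonglongrightarrow> 0"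
      by (intro real_tendsto_divide_at_top [OF tendsto_const])
    then show ?thesis by (simp add: hypergeo_term_def B_def Suc mult.commute)
  qed
  have bound: "norm (hypergeo_term a b (c + real n) k) \<le> hypergeo_term a b c k" for n k
  proof -
    have "0 \<le> pochhammer a k" "0 \<le> pochhammer b k"
      using assms by (simp_all add: pochhammer_nonneg pochhammer_prod prod_nonneg)
    moreover have "0 < pochhammer c k" "pochhammer c k \<le> pochhammer (c + real n) k"
      using c by (auto simp: pochhammer_prod intro!: prod_mono prod_pos)
    ultimately show ?thesis
      unfolding hypergeo_term_def
      by (simp add: abs_mult) (intro divide_left_mono mult_right_mono mult_nonneg_nonneg mult_pos_pos; simp)
  qed
  have "(\<lambda>n. suminf (\<lambda>k. hypergeo_term a b (c + real n) k)) \<longlonglongrightarrow> suminf B"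
    using tannerys_theorem [where a = "\<lambda>k n. hypergeo_term a b (c + real n) k" and b = B
        and F = sequentially and M = "hypergeo_term a b c", OF lim]
      hypergeo_term_limits(2) [of c a b] c assms bound by (auto simp: case_prod_unfold)
  moreover have "suminf B = 1"
    unfolding B_def using sums_single [of 0 "\<lambda>_. 1 :: real"] by (auto dest: sums_unique)
  ultimately show ?thesis by simp
qed

text \<open>
  Iterating \<open>gauss_contiguous\<close> pushes \<open>c\<close> to infinity, where the series tends to \<open>1\<close>; the
  accumulated quotient of Pochhammer symbols converges by Euler's product.  The powers of \<open>n\<close> in the
  four factors cancel because \<open>c + (c - a - b) = (c - a) + (c - b)\<close>.
\<close>
theorem gauss_summation:
  assumes "a \<ge> 0" "b \<ge> 0" "c > a + b"
  shows "suminf (hypergeo_term a b c) = Gamma c * Gamma (c - a - b) * (rGamma (c - a) * rGamma (c - b))"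
proof -
  have c: "c > 0" using assms by linarith
  define F where "F n = suminf (hypergeo_term a b (c + real n))" for n
  have iter: "pochhammer c n * pochhammer (c - a - b) n * F 0 =
      pochhammer (c - a) n * pochhammer (c - b) n * F n" for n
  proof (induction n)
    case (Suc n)
    have "(c + real n) * (c - a - b + real n) * F n =
        (c - a + real n) * (c - b + real n) * F (Suc n)"
      using gauss_contiguous [of "c + real n" a b] c assms by (simp add: F_def algebra_simps)
    then have "(pochhammer (c - a) n * pochhammer (c - b) n) * ((c + real n) * (c - a - b + real n) * F n) =
        (pochhammer (c - a) n * pochhammer (c - b) n) * ((c - a + real n) * (c - b + real n) * F (Suc n))"
      by simp
    moreover have "((c + real n) * (c - a - b + real n)) * (pochhammer c n * pochhammer (c - a - b) n * F 0) =
        ((c + real n) * (c - a - b + real n)) * (pochhammer (c - a) n * pochhammer (c - b) n * F n)"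
      by (simp only: Suc.IH)
    ultimately show ?case
      unfolding pochhammer_Suc by (simp only: mult_ac)
  qed (simp add: F_def)
  have eq: "rGamma_series c n * rGamma_series (c - a - b) n * F 0 =
      rGamma_series (c - a) n * rGamma_series (c - b) n * F (Suc n)" for n
  proof -
    have "exp (c * ln (real n)) * exp ((c - a - b) * ln (real n)) =
        exp ((c - a) * ln (real n)) * exp ((c - b) * ln (real n))"
      by (simp add: exp_add [symmetric] algebra_simps)
    then have "(pochhammer c (Suc n) * pochhammer (c - a - b) (Suc n) * F 0) /
          ((fact n * fact n) * (exp (c * ln (real n)) * exp ((c - a - b) * ln (real n)))) =
        (pochhammer (c - a) (Suc n) * pochhammer (c - b) (Suc n) * F (Suc n)) /
          ((fact n * fact n) * (exp ((c - a) * ln (real n)) * exp ((c - b) * ln (real n))))"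
      by (simp only: iter)
    then show ?thesis
      by (simp add: rGamma_series_def mult_ac del: of_nat_Suc)
  qed
  have "F \<longlonglongrightarrow> 1"
    unfolding F_def by (rule hypergeo_suminf_tendsto_1 [OF assms])
  then have "(\<lambda>n. F (Suc n)) \<longlonglongrightarrow> 1" by (rule LIMSEQ_Suc)
  then have "(\<lambda>n. rGamma_series (c - a) n * rGamma_series (c - b) n * F (Suc n)) \<longlonglongrightarrow>
      rGamma (c - a) * rGamma (c - b) * 1"
    by (intro tendsto_intros)
  moreover have "(\<lambda>n. rGamma_series c n * rGamma_series (c - a - b) n * F 0) \<longlonglongrightarrow>
      rGamma c * rGamma (c - a - b) * F 0"
    by (intro tendsto_intros)
  ultimately have "rGamma c * rGamma (c - a - b) * F 0 = rGamma (c - a) * rGamma (c - b)"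
    using LIMSEQ_unique unfolding eq by fastforce
  then have "Gamma c * Gamma (c - a - b) * (rGamma (c - a) * rGamma (c - b)) =
      Gamma c * Gamma (c - a - b) * (rGamma c * rGamma (c - a - b) * F 0)"
    by simp
  also have "\<dots> = (Gamma c * rGamma c) * (Gamma (c - a - b) * rGamma (c - a - b)) * F 0"
    by (simp only: mult_ac)
  also have "Gamma c * rGamma c = 1"
    using Gamma_real_pos [OF c] by (simp add: rGamma_inverse_Gamma)
  also have "Gamma (c - a - b) * rGamma (c - a - b) = 1"
  proof -
    have "c - a - b > 0" using assms by simp
    from Gamma_real_pos [OF this] show ?thesis by (simp add: rGamma_inverse_Gamma)
  qed
  finally show ?thesis by (simp add: F_def)
qed

section \<open>Autocovariances of fractional noise\<close>

text \<open>
  Unlike the quotient of Gamma values, this form is uniform in \<open>D\<close>, including \<open>D = 0\<close>, so that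
  short-memory seasons need no separate treatment below.
\<close>
lemma frac_coeff_eq_pochhammer:
  assumes "D \<ge> 0"
  shows "frac_coeff D k = pochhammer D k / fact k"
proof (cases "D = 0")
  case True
  then show ?thesis by (cases k) (simp_all add: frac_coeff_def pochhammer_rec)
next
  case False
  then have "D \<notin> \<int>\<^sub>\<le>\<^sub>0" using assms nonpos_Ints_nonpos by fastforce
  then show ?thesis
    using False Gamma_fact [of k, where 'a = real]
    by (simp add: frac_coeff_def pochhammer_Gamma add_ac)
qed

text \<open>
  The autocovariance at lag \<open>h\<close> of \<open>(1 - L) powr (- D)\<close> applied to white noise of unit variance.
\<close>
definition frac_acv :: "real \<Rightarrow> nat \<Rightarrow> real" where
  "frac_acv D h = (\<Sum>k. frac_coeff D k * frac_coeff D (k + h))"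

lemma frac_acv_hypergeo:
  assumes "D \<ge> 0"
  shows "frac_coeff D k * frac_coeff D (k + h) =
    frac_coeff D h * hypergeo_term D (D + real h) (1 + real h) k"
proof -
  have "pochhammer D (k + h) = pochhammer D h * pochhammer (D + real h) k"
    using pochhammer_product' [of D h k] by (simp add: add.commute)
  moreover have "fact (k + h) = fact h * pochhammer (1 + real h) k"
    using pochhammer_product' [of "1 :: real" h k] by (simp add: add.commute pochhammer_fact)
  ultimately show ?thesis
    by (simp add: frac_coeff_eq_pochhammer assms hypergeo_term_def mult_ac)
qed

lemma frac_acv_sums:
  assumes "0 \<le> D" "D < 1 / 2"
  shows "(\<lambda>k. frac_coeff D k * frac_coeff D (k + h)) sums frac_acv D h"
  unfolding frac_acv_def using assms
  by (intro summable_sums) (simp add: frac_acv_hypergeo hypergeo_term_limits summable_mult)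

text \<open>
  The series is \<open>F(D, D + h; 1 + h; 1)\<close> up to a factor, and Gauss's theorem applies because
  \<open>1 + h - D - (D + h) = 1 - 2 * D\<close> is positive.
\<close>
lemma frac_acv_closed_form:
  assumes "0 \<le> D" "D < 1 / 2"
  shows "frac_acv D h = Gamma (1 - 2 * D) * (rGamma (1 - D))\<^sup>2 * (pochhammer D h / pochhammer (1 - D) h)"
proof -
  have "pochhammer (1 - D) h > 0" using assms by (intro pochhammer_pos) auto
  then have r: "rGamma (1 + real h - D) = rGamma (1 - D) / pochhammer (1 - D) h"
    using pochhammer_rGamma [of "1 - D" h] by (simp add: field_simps)
  have "frac_acv D h = frac_coeff D h * suminf (hypergeo_term D (D + real h) (1 + real h))"
    unfolding frac_acv_def using assms
    by (simp add: frac_acv_hypergeo suminf_mult hypergeo_term_limits)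
  also have "suminf (hypergeo_term D (D + real h) (1 + real h)) =
      Gamma (1 + real h) * Gamma (1 + real h - D - (D + real h)) *
      (rGamma (1 + real h - D) * rGamma (1 + real h - (D + real h)))"
    using assms by (intro gauss_summation) auto
  also have "1 + real h - D - (D + real h) = 1 - 2 * D" by simp
  also have "1 + real h - (D + real h) = 1 - D" by simp
  finally show ?thesis
    using assms by (simp add: r frac_coeff_eq_pochhammer Gamma_fact power2_eq_square)
qed

text \<open>
  Euler's product for the quotient of Pochhammer symbols.  For \<open>D = 0\<close> the limit is \<open>0\<close>, in accordance
  with \<open>Gamma 0 = 0\<close>.  With the base \<open>1 + h\<close> instead of \<open>h\<close> the normalisation does not vanish at
  lag \<open>0\<close>, so that a bound on the normalised sequence also controls that lag.
\<close>
lemma frac_acv_asymp: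
  assumes "0 \<le> D" "D < 1 / 2"
  shows "(\<lambda>h. frac_acv D h * (1 + real h) powr (1 - 2 * D)) \<longlonglongrightarrow>
    Gamma (1 - 2 * D) / (Gamma D * Gamma (1 - D))"
(* Shift by one: the n-th member of Euler's product contains n + 1 factors. *)
proof (rule LIMSEQ_imp_Suc)
  have g: "Gamma (1 - D) > 0" using assms by (intro Gamma_real_pos) auto
  have eq: "\<forall>\<^sub>F n in sequentially. Gamma (1 - 2 * D) * (rGamma (1 - D))\<^sup>2 *
        (rGamma_series D n / rGamma_series (1 - D) n) * ((2 + real n) / real n) powr (1 - 2 * D) =
      frac_acv D (Suc n) * (1 + real (Suc n)) powr (1 - 2 * D)"
    using eventually_gt_at_top [of 0]
  proof eventually_elim
    case (elim n)
    have "rGamma_series D n / rGamma_series (1 - D) n =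
        pochhammer D (Suc n) / pochhammer (1 - D) (Suc n) *
        (exp ((1 - D) * ln (real n)) / exp (D * ln (real n)))"
      by (simp add: rGamma_series_def)
    also have "exp ((1 - D) * ln (real n)) / exp (D * ln (real n)) = real n powr (1 - 2 * D)"
      using elim by (simp add: powr_def exp_diff [symmetric] algebra_simps)
    finally show ?case
      using elim assms by (simp add: frac_acv_closed_form powr_divide)
  qed
  have "(\<lambda>n. ((2 + real n) / real n) powr (1 - 2 * D)) \<longlonglongrightarrow> 1 powr (1 - 2 * D)"
    by (rule tendsto_powr [OF _ tendsto_const]) (real_asymp, simp)
  moreover have "rGamma (1 - D) \<noteq> 0"
    using g by (simp add: rGamma_inverse_Gamma)
  ultimately have "(\<lambda>n. Gamma (1 - 2 * D) * (rGamma (1 - D))\<^sup>2 *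
        (rGamma_series D n / rGamma_series (1 - D) n) * ((2 + real n) / real n) powr (1 - 2 * D))
      \<longlonglongrightarrow> Gamma (1 - 2 * D) * (rGamma (1 - D))\<^sup>2 * (rGamma D / rGamma (1 - D)) * 1 powr (1 - 2 * D)"
    by (intro tendsto_mult tendsto_divide tendsto_const rGamma_series_LIMSEQ)
  moreover have "Gamma (1 - 2 * D) * (rGamma (1 - D))\<^sup>2 * (rGamma D / rGamma (1 - D)) * 1 powr (1 - 2 * D) =
      Gamma (1 - 2 * D) / (Gamma D * Gamma (1 - D))"
    using g by (simp add: rGamma_inverse_Gamma field_simps power2_eq_square)
  ultimately show "(\<lambda>n. frac_acv D (Suc n) * (1 + real (Suc n)) powr (1 - 2 * D)) \<longlonglongrightarrow>
      Gamma (1 - 2 * D) / (Gamma D * Gamma (1 - D))"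
    using Lim_transform_eventually [OF _ eq] by simp
qed


section \<open>Filtering a regularly varying autocovariance\<close>

text \<open>
  Peetre's inequality: shifting a lag by \<open>n - m\<close> costs at most a factor that is polynomial
  in \<open>n\<close> and \<open>m\<close>.
\<close>
lemma lag_powr_le:
  assumes "0 \<le> \<beta>" "\<beta> \<le> 1"
  shows "(1 + real H) powr \<beta> \<le>
    (1 + real (nat \<bar>int H + int n - int m\<bar>)) powr \<beta> * ((1 + real n) * (1 + real m))"
proof -
  define k where "k = nat \<bar>int H + int n - int m\<bar>"
  have "1 + real H \<le> (1 + real k) + real m"
    unfolding k_def by linarith
  also have "\<dots> \<le> (1 + real k) * ((1 + real n) * (1 + real m))"
    by (simp add: algebra_simps)
  finally have "(1 + real H) powr \<beta> \<le> ((1 + real k) * ((1 + real n) * (1 + real m))) powr \<beta>"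
    using assms by (intro powr_mono2) auto
  also have "\<dots> = (1 + real k) powr \<beta> * ((1 + real n) * (1 + real m)) powr \<beta>"
    by (simp add: powr_mult)
  also have "((1 + real n) * (1 + real m)) powr \<beta> \<le> ((1 + real n) * (1 + real m)) powr 1"
    using assms by (intro powr_mono) (auto simp: algebra_simps)
  finally show ?thesis by (simp add: k_def mult_left_mono)
qed

text \<open>
  Tannery's theorem for one sequence index with a bound valid everywhere, together with the
  estimate of the sum that is needed to use it a second time on an outer series.
\<close>
lemma tannery_sequence:
  fixes f :: "nat \<Rightarrow> nat \<Rightarrow> real"
  assumes "\<And>k. (\<lambda>n. f k n) \<longlonglongrightarrow> l k" "\<And>k n. \<bar>f k n\<bar> \<le> B k" "summable B"
  shows "(\<lambda>n. \<Sum>k. f k n) \<longlonglongrightarrow> suminf l" "summable (\<lambda>k. f k n)" "\<bar>\<Sum>k. f k n\<bar> \<le> suminf B"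
proof -
  show "(\<lambda>n. \<Sum>k. f k n) \<longlonglongrightarrow> suminf l"
    using tannerys_theorem [where a = f and b = l and F = sequentially and M = B] assms
    by (auto simp: case_prod_unfold)
  have s: "summable (\<lambda>k. \<bar>f k n\<bar>)"
    by (rule summable_comparison_test' [OF assms(3), of 0]) (simp add: assms(2))
  then show "summable (\<lambda>k. f k n)" by (rule summable_rabs_cancel)
  show "\<bar>\<Sum>k. f k n\<bar> \<le> suminf B"
    using summable_rabs [OF s] suminf_le [OF assms(2) s assms(3)] by linarith
qed

text \<open>
  Passing two series through absolutely summable filters multiplies the leading constant of their
  cross-covariance by the sums of the filter coefficients.  By \<open>lag_powr_le\<close> the normalised terms are
  bounded by \<open>K * (1 + n) * (1 + m)\<close>, which the weighted summability of \<open>a\<close> and \<open>b\<close> absorbs, so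
  Tannery's theorem applies to the inner and then to the outer sum.
\<close>
lemma filtered_acv_asymp:
  fixes a b :: "nat \<Rightarrow> real" and g :: "nat \<Rightarrow> real"
  assumes a: "summable (\<lambda>n. (1 + real n) * \<bar>a n\<bar>)" and b: "summable (\<lambda>n. (1 + real n) * \<bar>b n\<bar>)"
    and \<beta>: "0 \<le> \<beta>" "\<beta> \<le> 1"
    and g: "(\<lambda>h. g h * (1 + real h) powr \<beta>) \<longlonglongrightarrow> L"
  defines "T \<equiv> \<lambda>H n. \<Sum>m. b m * g (nat \<bar>int H + int n - int m\<bar>)"
  shows "summable (\<lambda>m. b m * g (nat \<bar>int H + int n - int m\<bar>))"
    and "summable (\<lambda>n. a n * T H n)"
    and "(\<lambda>H. (\<Sum>n. a n * T H n) * (1 + real H) powr \<beta>) \<longlonglongrightarrow> L * suminf a * suminf b"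
proof -
  obtain K where K: "\<And>h. \<bar>g h * (1 + real h) powr \<beta>\<bar> \<le> K"
    using convergent_imp_Bseq [of "\<lambda>h. g h * (1 + real h) powr \<beta>"] g
    unfolding convergent_def Bseq_def by auto
  define G where "G H n m = g (nat \<bar>int H + int n - int m\<bar>) * (1 + real H) powr \<beta>" for H n m
  have Gb: "\<bar>G H n m\<bar> \<le> K * ((1 + real n) * (1 + real m))" for H n m
  proof -
    let ?k = "nat \<bar>int H + int n - int m\<bar>"
    have "\<bar>G H n m\<bar> \<le> \<bar>g ?k\<bar> * ((1 + real ?k) powr \<beta> * ((1 + real n) * (1 + real m)))"
      unfolding G_def abs_mult using lag_powr_le [OF \<beta>] by (intro mult_left_mono) auto
    also have "\<dots> = \<bar>g ?k * (1 + real ?k) powr \<beta>\<bar> * ((1 + real n) * (1 + real m))"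
      by (simp add: abs_mult)
    also have "\<dots> \<le> K * ((1 + real n) * (1 + real m))"
      by (intro mult_right_mono K) auto
    finally show ?thesis .
  qed
  have Glim: "(\<lambda>H. G H n m) \<longlonglongrightarrow> L" for n m
  proof -
    let ?k = "\<lambda>H. nat \<bar>int H + int n - int m\<bar>"
    have "filterlim ?k at_top sequentially"
      unfolding filterlim_at_top
    proof
      fix Z
      show "\<forall>\<^sub>F H in sequentially. Z \<le> ?k H"
        using eventually_ge_at_top [of "Z + m"] by eventually_elim linarith
    qed
    then have "(\<lambda>H. g (?k H) * (1 + real (?k H)) powr \<beta>) \<longlonglongrightarrow> L"
      by (rule filterlim_compose [OF g])
    moreover have "(\<lambda>H. ((1 + real H) / (1 + (real H + real n - real m))) powr \<beta>) \<longlonglongrightarrow> 1 powr \<beta>"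
      by (rule tendsto_powr [OF _ tendsto_const]) (real_asymp, simp)
    ultimately have "(\<lambda>H. (g (?k H) * (1 + real (?k H)) powr \<beta>) *
        ((1 + real H) / (1 + (real H + real n - real m))) powr \<beta>) \<longlonglongrightarrow> L * 1 powr \<beta>"
      by (rule tendsto_mult)
    moreover have "\<forall>\<^sub>F H in sequentially. (g (?k H) * (1 + real (?k H)) powr \<beta>) *
        ((1 + real H) / (1 + (real H + real n - real m))) powr \<beta> = G H n m"
      using eventually_ge_at_top [of m]
    proof eventually_elim
      case (elim H)
      then have "real H + real n - real m = real (?k H)" by linarith
      then show ?case
        by (simp add: G_def powr_divide)
    qed
    ultimately show ?thesis using Lim_transform_eventually by fastforce
  qed
  have inner_lim: "(\<lambda>H. b m * G H n m) \<longlonglongrightarrow> b m * L" for n m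
    by (intro tendsto_intros Glim)
  have inner_bound: "\<bar>b m * G H n m\<bar> \<le> K * (1 + real n) * ((1 + real m) * \<bar>b m\<bar>)" for n m H
    using mult_left_mono [OF Gb [of H n m], of "\<bar>b m\<bar>"] by (simp add: abs_mult mult_ac)
  have inner_sum: "summable (\<lambda>m. K * (1 + real n) * ((1 + real m) * \<bar>b m\<bar>))" for n
    by (intro summable_mult b)
  note inner = tannery_sequence [where f = "\<lambda>m H. b m * G H n m" and l = "\<lambda>m. b m * L" for n,
      OF inner_lim inner_bound inner_sum]
  have pos: "(1 + real H) powr \<beta> > 0" for H by simp
  have unscale: "b m * g (nat \<bar>int H + int n - int m\<bar>) = (b m * G H n m) / (1 + real H) powr \<beta>" for m n H
    using pos [of H] by (simp add: G_def del: powr_gt_zero)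
  show inner_summable: "summable (\<lambda>m. b m * g (nat \<bar>int H + int n - int m\<bar>))" for H n
    unfolding unscale by (intro summable_divide inner(2))
  have scale: "T H n * (1 + real H) powr \<beta> = (\<Sum>m. b m * G H n m)" for H n
    unfolding T_def by (subst suminf_mult2 [OF inner_summable]) (simp add: G_def mult_ac)
  define B where "B = (\<Sum>m. (1 + real m) * \<bar>b m\<bar>)"
  have outer_lim: "(\<lambda>H. a n * (T H n * (1 + real H) powr \<beta>)) \<longlonglongrightarrow> a n * (\<Sum>m. b m * L)" for n
    unfolding scale by (intro tendsto_intros inner(1))
  have outer_bound: "\<bar>a n * (T H n * (1 + real H) powr \<beta>)\<bar> \<le> (K * B) * ((1 + real n) * \<bar>a n\<bar>)" for n H
  proof -
    have "\<bar>\<Sum>m. b m * G H n m\<bar> \<le> K * (1 + real n) * B"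
      using inner(3) [of H n] by (simp add: B_def suminf_mult [OF b])
    from mult_left_mono [OF this, of "\<bar>a n\<bar>"] show ?thesis
      by (simp add: scale abs_mult mult_ac)
  qed
  have outer_sum: "summable (\<lambda>n. (K * B) * ((1 + real n) * \<bar>a n\<bar>))"
    by (intro summable_mult a)
  note outer = tannery_sequence [OF outer_lim outer_bound outer_sum]
  have unscale': "a n * T H n = (a n * (T H n * (1 + real H) powr \<beta>)) / (1 + real H) powr \<beta>" for n H
    using pos [of H] by (simp del: powr_gt_zero)
  show outer_summable: "summable (\<lambda>n. a n * T H n)" for H
    by (subst unscale') (intro summable_divide outer(2))
  have abs: "summable c" if "summable (\<lambda>n. (1 + real n) * \<bar>c n\<bar>)" for c :: "nat \<Rightarrow> real"
    by (rule summable_comparison_test' [OF that, of 0]) (simp add: algebra_simps)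
  have "(\<Sum>n. a n * (\<Sum>m. b m * L)) = L * suminf a * suminf b"
    by (simp add: suminf_mult2 [OF abs [OF a], symmetric] suminf_mult2 [OF abs [OF b], symmetric])
  moreover have "(\<Sum>n. a n * (T H n * (1 + real H) powr \<beta>)) = (\<Sum>n. a n * T H n) * (1 + real H) powr \<beta>" for H
    by (subst suminf_mult2 [OF outer_summable]) (simp add: mult_ac)
  ultimately show "(\<lambda>H. (\<Sum>n. a n * T H n) * (1 + real H) powr \<beta>) \<longlonglongrightarrow> L * suminf a * suminf b"
    using outer(1) by simp
qed

section \<open>The inverse of the autoregressive matrix polynomial\<close>

lemma mat_mult_index:
  assumes "A \<in> carrier_mat n n" "B \<in> carrier_mat n n" "s < n" "k < n"
  shows "(A * B) $$ (s, k) = (\<Sum>l<n. A $$ (s, l) * B $$ (l, k))"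
  using assms by (auto simp: scalar_prod_def lessThan_atLeast0 intro!: sum.cong)

lemma inv_mat_works:
  assumes "A \<in> carrier_mat n n" "Determinant.det A \<noteq> 0"
  shows "inv_mat A \<in> carrier_mat n n" "A * inv_mat A = 1\<^sub>m n" "inv_mat A * A = 1\<^sub>m n"
proof -
  have "mat_inverse A \<noteq> None"
    using mat_inverse(1) [OF assms(1), where b = n] det_non_zero_imp_unit [OF assms, where b = n] by blast
  then obtain B where "mat_inverse A = Some B" by blast
  with mat_inverse(2) [OF assms(1) this]
  show "inv_mat A \<in> carrier_mat n n" "A * inv_mat A = 1\<^sub>m n" "inv_mat A * A = 1\<^sub>m n"
    by (simp_all add: inv_mat_def)
qed

lemma Phi_coeff_carrier: "Phi_coeff S p \<phi> n \<in> carrier_mat S S"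
  by (simp add: Phi_coeff_def Phi0_def Phi_def)

lemma Phi0_carrier: "Phi0 S \<phi> \<in> carrier_mat S S"
  by (simp add: Phi0_def)

lemma det_Phi0: "Determinant.det (Phi0 S \<phi>) = 1"
proof -
  have "Determinant.det (Phi0 S \<phi>) = prod_list (diag_mat (Phi0 S \<phi>))"
    by (rule det_lower_triangular [OF _ Phi0_carrier]) (auto simp: Phi0_def)
  also have "diag_mat (Phi0 S \<phi>) = map (\<lambda>_. 1) [0..<S]"
    by (auto simp: diag_mat_def Phi0_def intro!: map_cong)
  also have "prod_list \<dots> = (1 :: real)"
    by (induction S) auto
  finally show ?thesis .
qed

lemma Phi_one_index:
  assumes "s < S" "k < S"
  shows "Phi_one S p \<phi> $$ (s, k) = (\<Sum>n\<le>P_order S p. Phi_coeff S p \<phi> n $$ (s, k))"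
proof -
  have "{..P_order S p} = insert 0 {1..P_order S p}" by auto
  then have "(\<Sum>n\<le>P_order S p. Phi_coeff S p \<phi> n $$ (s, k)) =
      Phi0 S \<phi> $$ (s, k) + (\<Sum>n=1..P_order S p. - Phi S \<phi> n $$ (s, k))"
    using assms by (simp add: Phi_coeff_def Phi_def)
  then show ?thesis
    using assms by (simp add: Phi_one_def sum_negf)
qed

text \<open>
  \<open>\<Phi>(x)\<close> as a matrix of complex polynomials; the adjugate formula then holds over the polynomial
  ring and can be transported both to values at a point and to formal power series.
\<close>
definition AR_poly_mat :: "nat \<Rightarrow> nat \<Rightarrow> (int \<Rightarrow> nat \<Rightarrow> real) \<Rightarrow> complex poly mat" where
  "AR_poly_mat S p \<phi> = Matrix.mat S S (\<lambda>(s, k).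
     \<Sum>n\<le>P_order S p. monom (complex_of_real (Phi_coeff S p \<phi> n $$ (s, k))) n)"

lemma AR_poly_mat_carrier: "AR_poly_mat S p \<phi> \<in> carrier_mat S S"
  by (simp add: AR_poly_mat_def)

lemma poly_AR_poly_mat:
  assumes "s < S" "k < S"
  shows "poly (AR_poly_mat S p \<phi> $$ (s, k)) x =
    (\<Sum>n\<le>P_order S p. complex_of_real (Phi_coeff S p \<phi> n $$ (s, k)) * x ^ n)"
  using assms by (simp add: AR_poly_mat_def poly_sum poly_monom)

lemma coeff_AR_poly_mat:
  assumes "s < S" "k < S"
  shows "coeff (AR_poly_mat S p \<phi> $$ (s, k)) i = complex_of_real (Phi_coeff S p \<phi> i $$ (s, k))"
  using assms by (simp add: AR_poly_mat_def coeff_sum if_distrib [of "\<lambda>p. coeff p _"])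
    (auto simp: Phi_coeff_def)

interpretation poly_eval_hom: comm_ring_hom "\<lambda>q. poly q (x :: complex)" for x
  by unfold_locales simp_all

lemma poly_det_AR:
  "poly (Determinant.det (AR_poly_mat S p \<phi>)) x =
    Determinant.det (map_mat (\<lambda>q. poly q x) (AR_poly_mat S p \<phi>))"
  by (simp add: poly_eval_hom.hom_det)

lemma det_AR_0: "poly (Determinant.det (AR_poly_mat S p \<phi>)) 0 = 1"
proof -
  have "map_mat (\<lambda>q. poly q 0) (AR_poly_mat S p \<phi>) = map_mat complex_of_real (Phi0 S \<phi>)"
    using coeff_AR_poly_mat [of _ S _ p \<phi> 0]
    by (intro eq_matI) (auto simp: AR_poly_mat_carrier [THEN carrier_matD(1)]
        AR_poly_mat_carrier [THEN carrier_matD(2)] Phi0_carrier [THEN carrier_matD(1)]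
        Phi0_carrier [THEN carrier_matD(2)] poly_0_coeff_0 Phi_coeff_def)
  then show ?thesis
    by (simp add: poly_det_AR of_real_hom.hom_det det_Phi0)
qed

lemma det_AR_1:
  "poly (Determinant.det (AR_poly_mat S p \<phi>)) 1 = complex_of_real (Determinant.det (Phi_one S p \<phi>))"
proof -
  have "map_mat (\<lambda>q. poly q 1) (AR_poly_mat S p \<phi>) = map_mat complex_of_real (Phi_one S p \<phi>)"
  proof (rule eq_matI)
    fix s k assume "s < dim_row (map_mat complex_of_real (Phi_one S p \<phi>))"
      "k < dim_col (map_mat complex_of_real (Phi_one S p \<phi>))"
    then have sk: "s < S" "k < S" by (simp_all add: Phi_one_def)
    then have "s < dim_row (AR_poly_mat S p \<phi>)" "k < dim_col (AR_poly_mat S p \<phi>)"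
      "s < dim_row (Phi_one S p \<phi>)" "k < dim_col (Phi_one S p \<phi>)"
      by (simp_all add: AR_poly_mat_def Phi_one_def)
    then show "map_mat (\<lambda>q. poly q 1) (AR_poly_mat S p \<phi>) $$ (s, k) =
        map_mat complex_of_real (Phi_one S p \<phi>) $$ (s, k)"
      using sk by (simp add: poly_AR_poly_mat Phi_one_index)
  qed (simp_all add: AR_poly_mat_def Phi_one_def)
  then show ?thesis
    by (simp add: poly_det_AR of_real_hom.hom_det)
qed

text \<open>
  \<open>\<Phi>(x) = \<Phi>0 * (I - (\<Sum>i. \<Phi>0^(-1) * \<Phi> i * x^i))\<close>, and the second factor is the
  characteristic matrix at \<open>1 / x\<close> with its powers reversed.
\<close>
lemma map_AR_factor:
  assumes x: "x \<noteq> 0"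
  shows "map_mat (\<lambda>q. poly q x) (AR_poly_mat S p \<phi>) =
    map_mat complex_of_real (Phi0 S \<phi>) * (x ^ P_order S p \<cdot>\<^sub>m char_mat S p \<phi> (inverse x))"
    (is "?L = ?A * ?B")
proof (rule eq_matI)
  let ?P = "P_order S p"
  let ?W = "\<lambda>i. inv_mat (Phi0 S \<phi>) * Phi S \<phi> i"
  note inv = inv_mat_works [OF Phi0_carrier [of S \<phi>], unfolded det_Phi0, simplified]
  have carr: "?A \<in> carrier_mat S S" "?B \<in> carrier_mat S S"
    by (simp_all add: Phi0_def char_mat_def)
  fix s k assume "s < dim_row (?A * ?B)" "k < dim_col (?A * ?B)"
  then have sk: "s < S" "k < S" by (simp_all add: Phi0_def char_mat_def)
  have Phi_c: "Phi S \<phi> i \<in> carrier_mat S S" for i by (simp add: Phi_def)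
  have W: "(\<Sum>l<S. Phi0 S \<phi> $$ (s, l) * ?W i $$ (l, k)) = Phi S \<phi> i $$ (s, k)" for i
  proof -
    have "Phi0 S \<phi> * ?W i = Phi S \<phi> i"
      using assoc_mult_mat [OF Phi0_carrier inv(1) Phi_c [of i], of \<phi>] inv Phi_c [of i] by simp
    then show ?thesis
      using mat_mult_index [OF Phi0_carrier mult_carrier_mat [OF inv(1) Phi_c] sk] by metis
  qed
  have B: "?B $$ (l, k) = (if l = k then 1 else 0) - (\<Sum>i=1..?P. complex_of_real (?W i $$ (l, k)) * x ^ i)"
    if l: "l < S" for l
  proof -
    have "x ^ ?P * inverse x ^ (?P - i) = x ^ i" if "i \<in> {1..?P}" for i
      using x that by (auto simp: power_diff field_simps)
    then have "x ^ ?P * (\<Sum>i=1..?P. complex_of_real (?W i $$ (l, k)) * inverse x ^ (?P - i)) =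
        (\<Sum>i=1..?P. complex_of_real (?W i $$ (l, k)) * x ^ i)"
      by (auto simp: sum_distrib_left mult.left_commute intro!: sum.cong)
    moreover have "x ^ ?P * inverse x ^ ?P = 1"
      using x by (simp flip: power_mult_distrib)
    ultimately show ?thesis
      using l sk by (simp add: char_mat_def right_diff_distrib)
  qed
  have "(?A * ?B) $$ (s, k) = (\<Sum>l<S. complex_of_real (Phi0 S \<phi> $$ (s, l)) * ?B $$ (l, k))"
    using mat_mult_index [OF carr sk] sk Phi0_carrier [of S \<phi>] by simp
  also have "\<dots> = (\<Sum>l<S. complex_of_real (Phi0 S \<phi> $$ (s, l)) * (if l = k then 1 else 0)) -
      (\<Sum>l<S. \<Sum>i=1..?P. complex_of_real (Phi0 S \<phi> $$ (s, l) * ?W i $$ (l, k)) * x ^ i)"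
    by (simp add: B right_diff_distrib sum_subtractf sum_distrib_left mult.assoc)
  also have "(\<Sum>l<S. \<Sum>i=1..?P. complex_of_real (Phi0 S \<phi> $$ (s, l) * ?W i $$ (l, k)) * x ^ i) =
      (\<Sum>i=1..?P. complex_of_real (\<Sum>l<S. Phi0 S \<phi> $$ (s, l) * ?W i $$ (l, k)) * x ^ i)"
    by (subst sum.swap) (simp add: sum_distrib_right)
  also have "(\<Sum>l<S. complex_of_real (Phi0 S \<phi> $$ (s, l)) * (if l = k then 1 else 0)) =
      complex_of_real (Phi0 S \<phi> $$ (s, k))"
    using sk by (simp add: if_distrib cong: if_cong)
  finally have R: "(?A * ?B) $$ (s, k) =
      complex_of_real (Phi0 S \<phi> $$ (s, k)) - (\<Sum>i=1..?P. complex_of_real (Phi S \<phi> i $$ (s, k)) * x ^ i)"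
    by (simp only: W)
  have "{..?P} = insert 0 {1..?P}" by auto
  then have "?L $$ (s, k) =
      complex_of_real (Phi0 S \<phi> $$ (s, k)) - (\<Sum>i=1..?P. complex_of_real (Phi S \<phi> i $$ (s, k)) * x ^ i)"
    using sk AR_poly_mat_carrier [of S p \<phi>]
    by (simp add: poly_AR_poly_mat Phi_coeff_def Phi_def sum_negf)
  with R show "?L $$ (s, k) = (?A * ?B) $$ (s, k)" by simp
qed (simp_all add: AR_poly_mat_def Phi0_def char_mat_def)

text \<open>
  A zero \<open>x \<noteq> 0\<close> in the closed unit disc would give a characteristic root \<open>1 / x\<close> outside the
  open disc; at \<open>0\<close> the determinant is that of the unitriangular matrix \<open>\<Phi>0\<close>.
\<close>
lemma det_AR_nonzero:
  assumes root: "\<forall>z::complex. Determinant.det (char_mat S p \<phi> z) = 0 \<longrightarrow> cmod z < 1"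
    and x: "cmod x \<le> 1"
  shows "poly (Determinant.det (AR_poly_mat S p \<phi>)) x \<noteq> 0"
proof (cases "x = 0")
  case True
  then show ?thesis by (simp add: det_AR_0)
next
  case False
  have "cmod (inverse x) \<ge> 1"
    using x False by (simp add: norm_inverse one_le_inverse_iff)
  then have "Determinant.det (char_mat S p \<phi> (inverse x)) \<noteq> 0"
    using root by force
  moreover have "Determinant.det (map_mat complex_of_real (Phi0 S \<phi>)) = 1"
    by (simp add: of_real_hom.hom_det det_Phi0)
  ultimately show ?thesis
    unfolding poly_det_AR map_AR_factor [OF False]
    by (subst det_mult [where n = S]) (use False in \<open>auto simp: Phi0_def char_mat_def\<close>)
qed

text \<open>
  A nonzero polynomial has finitely many zeros, so the smallest of their moduli is attained.
\<close>
lemma poly_nonzero_larger_disc: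
  fixes q :: "complex poly"
  assumes "\<And>x. cmod x \<le> 1 \<Longrightarrow> poly q x \<noteq> 0"
  obtains r where "r > 1" "\<And>x. cmod x < r \<Longrightarrow> poly q x \<noteq> 0"
proof -
  have "q \<noteq> 0" using assms [of 0] by auto
  then have fin: "finite (insert 2 (cmod ` {x. poly q x = 0}))"
    by (simp add: poly_roots_finite)
  define r where "r = Min (insert 2 (cmod ` {x. poly q x = 0}))"
  have "r > 1"
    unfolding r_def using fin assms by (subst Min_gr_iff) (auto simp: not_le [symmetric])
  moreover have "poly q x \<noteq> 0" if "cmod x < r" for x
  proof
    assume "poly q x = 0"
    then have "r \<le> cmod x" unfolding r_def by (intro Min_le fin) auto
    with that show False by simp
  qed
  ultimately show ?thesis using that by blast
qed

interpretation fps_of_poly_hom: comm_ring_hom "fps_of_poly :: complex poly \<Rightarrow> complex fps"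
  by unfold_locales (simp_all add: fps_of_poly_add fps_of_poly_mult)

text \<open>
  The series of \<open>f\<close> and of its derivative both converge absolutely at \<open>1\<close>.
\<close>
lemma summable_weighted_coeffs:
  fixes f :: "complex fps"
  assumes "fps_conv_radius f > 1"
  shows "summable (\<lambda>n. (1 + real n) * cmod (fps_nth f n))"
proof -
  have "summable (\<lambda>n. cmod (fps_nth f n * 1 ^ n))"
    by (rule norm_summable_fps) (use assms in \<open>simp add: one_ereal_def\<close>)
  then have 1: "summable (\<lambda>n. cmod (fps_nth f (Suc n)))"
    by (subst summable_Suc_iff) simp
  have "summable (\<lambda>n. cmod (fps_nth (fps_deriv f) n * 1 ^ n))"
    by (rule norm_summable_fps)
      (use assms fps_conv_radius_deriv [of f] in \<open>simp add: one_ereal_def\<close>)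
  then have 2: "summable (\<lambda>n. (1 + real n) * cmod (fps_nth f (Suc n)))"
    by (simp add: norm_mult del: of_nat_Suc) (simp add: add.commute)
  from summable_add [OF 1 2] have "summable (\<lambda>n. (1 + real (Suc n)) * cmod (fps_nth f (Suc n)))"
    by (simp add: algebra_simps)
  then show ?thesis by (subst (asm) summable_Suc_iff)
qed

text \<open>
  Let \<open>F\<close> be the generating series of \<open>Pc\<close>, with \<open>A * F = 1\<close> for the matrix \<open>A\<close> of polynomials.
  Multiplying by the adjugate gives \<open>det A * F = adj A\<close>.  Hence each entry of \<open>F\<close> is a polynomial divided by
  \<open>det A\<close>, which has no zeros in a disc of radius above \<open>1\<close>; and \<open>det A * (F * A) = adj A * A = det A * I\<close>
  shows, after cancelling \<open>det A\<close>, that \<open>F\<close> is a left inverse too.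
\<close>
theorem inverse_coeffs_properties:
  assumes root: "\<forall>z::complex. Determinant.det (char_mat S p \<phi> z) = 0 \<longrightarrow> cmod z < 1"
    and Pc: "Phi_inverse_coeffs S p \<phi> Pc"
    and sk: "s < S" "k < S"
  shows inverse_coeffs_summable: "summable (\<lambda>n. (1 + real n) * \<bar>Pc n $$ (s, k)\<bar>)"
    and inverse_coeffs_left: "(\<Sum>i\<le>n. \<Sum>l<S. Pc (n - i) $$ (s, l) * Phi_coeff S p \<phi> i $$ (l, k)) =
      (if n = 0 \<and> s = k then 1 else 0)"
proof -
  define A where "A = AR_poly_mat S p \<phi>"
  define q where "q = Determinant.det A"
  define Af where "Af = map_mat fps_of_poly A"
  define Q where "Q = fps_of_poly q"
  define R where "R = map_mat fps_of_poly (adj_mat A)"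
  define F where "F = Matrix.mat S S (\<lambda>(s, k). Abs_fps (\<lambda>n. complex_of_real (Pc n $$ (s, k))))"
  have Pc_c: "Pc n \<in> carrier_mat S S" for n using Pc by (simp add: Phi_inverse_coeffs_def)
  have A: "A \<in> carrier_mat S S" by (simp add: A_def AR_poly_mat_carrier)
  have Af: "Af \<in> carrier_mat S S" using A by (simp add: Af_def)
  have R: "R \<in> carrier_mat S S" using adj_mat(1) [OF A] by (simp add: R_def)
  have F: "F \<in> carrier_mat S S" by (simp add: F_def)
  have RA: "R * Af = Q \<cdot>\<^sub>m 1\<^sub>m S"
  proof -
    have "R * Af = map_mat fps_of_poly (adj_mat A * A)"
      unfolding R_def Af_def by (rule fps_of_poly_hom.mat_hom_mult [OF adj_mat(1) [OF A] A, symmetric])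
    also have "\<dots> = map_mat fps_of_poly (q \<cdot>\<^sub>m 1\<^sub>m S)"
      by (simp add: adj_mat(3) [OF A] q_def)
    also have "\<dots> = Q \<cdot>\<^sub>m 1\<^sub>m S"
      by (intro eq_matI) (auto simp: Q_def)
    finally show ?thesis .
  qed
  have AF: "Af * F = 1\<^sub>m S"
  proof (rule eq_matI)
    fix s k assume "s < dim_row (1\<^sub>m S :: complex fps mat)" "k < dim_col (1\<^sub>m S :: complex fps mat)"
    then have sk: "s < S" "k < S" by auto
    show "(Af * F) $$ (s, k) = 1\<^sub>m S $$ (s, k)"
    proof (rule fps_ext)
      fix n
      have "fps_nth ((Af * F) $$ (s, k)) n =
          (\<Sum>l<S. fps_nth (fps_of_poly (A $$ (s, l)) * F $$ (l, k)) n)"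
        using mat_mult_index [OF Af F sk] A sk by (simp add: Af_def fps_sum_nth)
      also have "\<dots> = (\<Sum>l<S. \<Sum>i\<le>n. complex_of_real (Phi_coeff S p \<phi> i $$ (s, l) * Pc (n - i) $$ (l, k)))"
        using sk by (intro sum.cong refl)
          (simp add: fps_mult_nth A_def coeff_AR_poly_mat F_def atLeast0AtMost)
      also have "\<dots> = complex_of_real (\<Sum>i\<le>n. (Phi_coeff S p \<phi> i * Pc (n - i)) $$ (s, k))"
        by (subst sum.swap) (simp add: mat_mult_index [OF Phi_coeff_carrier Pc_c sk])
      also have "\<dots> = fps_nth (1\<^sub>m S $$ (s, k)) n"
        using Pc sk by (simp add: Phi_inverse_coeffs_def)
      finally show "fps_nth ((Af * F) $$ (s, k)) n = fps_nth (1\<^sub>m S $$ (s, k)) n" .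
    qed
  qed (use Af F in auto)
  have QF: "Q \<cdot>\<^sub>m F = R"
  proof -
    have "Q \<cdot>\<^sub>m F = (Q \<cdot>\<^sub>m 1\<^sub>m S) * F"
      using F by (simp add: mult_smult_assoc_mat [OF one_carrier_mat])
    also have "\<dots> = R * (Af * F)"
      unfolding RA [symmetric] by (rule assoc_mult_mat [OF R Af F])
    finally show ?thesis using R by (simp add: AF)
  qed
  have q0: "poly q 0 \<noteq> 0"
    by (simp add: q_def A_def det_AR_0)
  then have Q0: "fps_nth Q 0 \<noteq> 0"
    by (simp add: Q_def poly_0_coeff_0)
  then have Qnz: "Q \<noteq> 0" by auto
  have QFA: "Q \<cdot>\<^sub>m (F * Af) = Q \<cdot>\<^sub>m 1\<^sub>m S"
    using mult_smult_assoc_mat [OF F Af, of Q] by (simp add: QF RA)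
  have FA: "(F * Af) $$ (s, k) = 1\<^sub>m S $$ (s, k)"
  proof -
    have "Q * (F * Af) $$ (s, k) = Q * 1\<^sub>m S $$ (s, k)"
      using arg_cong [OF QFA, of "\<lambda>M. M $$ (s, k)"] F Af sk by simp
    then show ?thesis using Qnz by simp
  qed
  have "complex_of_real (\<Sum>i\<le>n. \<Sum>l<S. Pc (n - i) $$ (s, l) * Phi_coeff S p \<phi> i $$ (l, k)) =
      fps_nth ((F * Af) $$ (s, k)) n"
  proof -
    have "fps_nth ((F * Af) $$ (s, k)) n =
        (\<Sum>l<S. fps_nth (fps_of_poly (A $$ (l, k)) * F $$ (s, l)) n)"
      using mat_mult_index [OF F Af sk] A sk by (simp add: Af_def fps_sum_nth mult.commute)
    also have "\<dots> = (\<Sum>l<S. \<Sum>i\<le>n. complex_of_real (Pc (n - i) $$ (s, l) * Phi_coeff S p \<phi> i $$ (l, k)))"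
      using sk by (intro sum.cong refl)
        (subst fps_mult_nth, simp add: A_def coeff_AR_poly_mat F_def atLeast0AtMost mult.commute)
    finally show ?thesis by (subst (asm) sum.swap) simp
  qed
  also have "\<dots> = complex_of_real (if n = 0 \<and> s = k then 1 else 0)"
    unfolding FA using sk by simp
  finally show "(\<Sum>i\<le>n. \<Sum>l<S. Pc (n - i) $$ (s, l) * Phi_coeff S p \<phi> i $$ (l, k)) =
      (if n = 0 \<and> s = k then 1 else 0)"
    by (simp only: of_real_eq_iff)
  obtain r where r: "r > 1" "\<And>x. cmod x < r \<Longrightarrow> poly q x \<noteq> 0"
    by (rule poly_nonzero_larger_disc [of q]) (use det_AR_nonzero [OF root] in \<open>auto simp: q_def A_def\<close>)
  have "fps_conv_radius (inverse Q) \<ge> min (ereal r) (fps_conv_radius Q)"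
    using r by (intro fps_conv_radius_inverse) (simp add: Q_def)
  then have "fps_conv_radius (inverse Q) \<ge> ereal r" by (simp add: Q_def)
  moreover have "F $$ (s, k) = fps_of_poly (adj_mat A $$ (s, k)) * inverse Q"
  proof -
    have "Q * F $$ (s, k) = fps_of_poly (adj_mat A $$ (s, k))"
      using arg_cong [OF QF, of "\<lambda>M. M $$ (s, k)"] F adj_mat(1) [OF A] sk by (simp add: R_def)
    then have "(inverse Q * Q) * F $$ (s, k) = inverse Q * fps_of_poly (adj_mat A $$ (s, k))"
      by (simp only: mult.assoc)
    then show ?thesis
      by (simp only: inverse_mult_eq_1 [OF Q0] mult_1_left) (simp only: mult.commute)
  qed
  ultimately have "fps_conv_radius (F $$ (s, k)) \<ge> ereal r"
    using fps_conv_radius_mult [of "fps_of_poly (adj_mat A $$ (s, k))" "inverse Q"]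
    by simp
  moreover have "ereal r > 1" using r by (simp add: one_ereal_def)
  ultimately have "fps_conv_radius (F $$ (s, k)) > 1" by (rule less_le_trans [rotated])
  from summable_weighted_coeffs [OF this]
  show "summable (\<lambda>n. (1 + real n) * \<bar>Pc n $$ (s, k)\<bar>)"
    using sk by (simp add: F_def)
qed

text \<open>
  Evaluating \<open>\<Phi>(L) * (\<Sum>j. Pc j * L^j) = I\<close> at \<open>L = 1\<close> is a Cauchy product of absolutely convergent
  series.
\<close>
theorem Phi_one_inverse:
  assumes root: "\<forall>z::complex. Determinant.det (char_mat S p \<phi> z) = 0 \<longrightarrow> cmod z < 1"
    and Pc: "Phi_inverse_coeffs S p \<phi> Pc"
  shows "invertible_mat (Phi_one S p \<phi>)"
    and "s < S \<Longrightarrow> k < S \<Longrightarrow> (\<lambda>n. Pc n $$ (s, k)) sums (inv_mat (Phi_one S p \<phi>) $$ (s, k))"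
proof -
  let ?P = "Phi_one S p \<phi>"
  have c: "?P \<in> carrier_mat S S" by (simp add: Phi_one_def)
  have "Determinant.det ?P \<noteq> 0"
    using det_AR_nonzero [OF root, of 1] by (auto simp: det_AR_1)
  note inv = inv_mat_works [OF c this]
  show "invertible_mat ?P"
    unfolding invertible_mat_def inverts_mat_def
    by (intro conjI exI [of _ "inv_mat ?P"]) (use c inv in auto)
  define G where "G = Matrix.mat S S (\<lambda>(s, k). \<Sum>n. Pc n $$ (s, k))"
  have G: "G \<in> carrier_mat S S" by (simp add: G_def)
  have Pc_c: "Pc n \<in> carrier_mat S S" for n using Pc by (simp add: Phi_inverse_coeffs_def)
  have abs: "summable (\<lambda>n. norm (Pc n $$ (s, k)))" if "s < S" "k < S" for s k
    by (rule summable_comparison_test' [OF inverse_coeffs_summable [OF root Pc that], of 0])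
      (simp add: algebra_simps)
  have "?P * G = 1\<^sub>m S"
  proof (rule eq_matI)
    fix s k assume "s < dim_row (1\<^sub>m S :: real mat)" "k < dim_col (1\<^sub>m S :: real mat)"
    then have sk: "s < S" "k < S" by auto
    have fin: "(\<lambda>n. Phi_coeff S p \<phi> n $$ (s, l)) sums (?P $$ (s, l))"
      "summable (\<lambda>n. norm (Phi_coeff S p \<phi> n $$ (s, l)))" if "l < S" for l
    proof -
      have z: "Phi_coeff S p \<phi> n $$ (s, l) = 0" if "n \<notin> {..P_order S p}" for n
        using that sk \<open>l < S\<close> by (simp add: Phi_coeff_def)
      show "(\<lambda>n. Phi_coeff S p \<phi> n $$ (s, l)) sums (?P $$ (s, l))"
        unfolding Phi_one_index [OF sk(1) that] by (rule sums_finite) (use z in auto)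
      show "summable (\<lambda>n. norm (Phi_coeff S p \<phi> n $$ (s, l)))"
        by (rule summable_finite [of "{..P_order S p}"]) (use z in auto)
    qed
    have "(\<lambda>n. \<Sum>l<S. \<Sum>i\<le>n. Phi_coeff S p \<phi> i $$ (s, l) * Pc (n - i) $$ (l, k)) sums
        (\<Sum>l<S. ?P $$ (s, l) * G $$ (l, k))"
    proof (rule sums_sum)
      fix l assume "l \<in> {..<S}"
      then have l: "l < S" by simp
      show "(\<lambda>n. \<Sum>i\<le>n. Phi_coeff S p \<phi> i $$ (s, l) * Pc (n - i) $$ (l, k)) sums (?P $$ (s, l) * G $$ (l, k))"
        using Cauchy_product_sums [OF fin(2) [OF l] abs [OF l sk(2)]] sums_unique [OF fin(1) [OF l]] l sk
        by (simp add: G_def)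
    qed
    moreover have "(\<Sum>l<S. \<Sum>i\<le>n. Phi_coeff S p \<phi> i $$ (s, l) * Pc (n - i) $$ (l, k)) =
        (if n = 0 then if s = k then 1 else 0 else 0)" for n
    proof -
      have "(\<Sum>l<S. \<Sum>i\<le>n. Phi_coeff S p \<phi> i $$ (s, l) * Pc (n - i) $$ (l, k)) =
          (\<Sum>i\<le>n. (Phi_coeff S p \<phi> i * Pc (n - i)) $$ (s, k))"
        by (subst sum.swap) (simp add: mat_mult_index [OF Phi_coeff_carrier Pc_c sk])
      then show ?thesis using Pc sk by (simp add: Phi_inverse_coeffs_def)
    qed
    ultimately have "(\<lambda>n. if n = 0 then if s = k then 1 else 0 else 0) sums (\<Sum>l<S. ?P $$ (s, l) * G $$ (l, k))"
      by simp
    then have "(\<Sum>l<S. ?P $$ (s, l) * G $$ (l, k)) = (if s = k then 1 else 0)"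
      using sums_single [of 0 "\<lambda>_. if s = k then 1 else 0 :: real"] sums_unique2 by fastforce
    then show "(?P * G) $$ (s, k) = 1\<^sub>m S $$ (s, k)"
      using sk by (simp add: mat_mult_index [OF c G])
  qed (use c G in auto)
  then have "inv_mat ?P = G"
    using assoc_mult_mat [OF inv(1) c G] inv c G by simp
  then show "(\<lambda>n. Pc n $$ (s, k)) sums (inv_mat ?P $$ (s, k))" if "s < S" "k < S"
    using summable_sums [OF summable_norm_cancel [OF abs [OF that]]] that by (simp add: G_def)
qed

section \<open>Inverting the periodic autoregression on bounded sequences\<close>

lemma periodic_shift:
  assumes "periodic S f"
  shows "f (int S * m + t) = f t"
proof (induction m rule: int_induct [where k = 0])
  case (step1 i)
  have "f (int S * (i + 1) + t) = f (int S * i + t + int S)"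
    by (simp add: algebra_simps)
  with step1 assms show ?case by (simp add: periodic_def)
next
  case (step2 i)
  have "f (int S * (i - 1) + t + int S) = f (int S * i + t)"
    by (simp add: algebra_simps)
  with step2 assms show ?case by (simp add: periodic_def)
qed simp

text \<open>
  The pair \<open>(n, k)\<close> stands for the lag \<open>n * S + s - k\<close>.  Block \<open>n = 0\<close> covers the lags \<open>0..s\<close> and
  block \<open>n + 1\<close> the lags \<open>n * S + s + 1..(n + 1) * S + s\<close>, so the blocks partition all lags up to
  \<open>P_order S p * S + s\<close>, and this bound is at least \<open>p\<close>.  The pairs \<open>(0, k)\<close> with \<open>k > s\<close> would be leads;
  their entries in \<open>\<Phi>0\<close> are \<open>0\<close>.
\<close>
lemma AR_vector_form:
  fixes z :: "int \<Rightarrow> real" and \<tau> :: int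
  assumes S: "S \<ge> 1" and per: "periodic S \<phi>" and zero: "\<forall>t i. i > p \<longrightarrow> \<phi> t i = 0" and s: "s < S"
  defines "t \<equiv> int S * \<tau> + int (s + 1)"
  shows "z t - (\<Sum>i=1..p. \<phi> t i * z (t - int i)) =
    (\<Sum>n\<le>P_order S p. \<Sum>k<S. Phi_coeff S p \<phi> n $$ (s, k) * z (int S * (\<tau> - int n) + int (k + 1)))"
proof -
  define f where "f i = \<phi> (int (s + 1)) i * z (t - int i)" for i
  define R where "R n = (\<Sum>k<S. Phi_coeff S p \<phi> n $$ (s, k) * z (int S * (\<tau> - int n) + int (k + 1)))" for n
  have lag: "z (int S * (\<tau> - int n) + int (k + 1)) = z (t - int (n * S + s - k))" if "k \<le> n * S + s" for n k
    using that by (simp add: t_def of_nat_diff algebra_simps)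
  have R0: "R 0 = z t - (\<Sum>i=1..s. f i)"
  proof -
    have "R 0 = (\<Sum>k\<in>{..<s} \<union> {s}. Phi0 S \<phi> $$ (s, k) * z (int S * \<tau> + int (k + 1)))"
      unfolding R_def using s
      by (intro sum.mono_neutral_cong_right) (auto simp: Phi_coeff_def Phi0_def)
    also have "\<dots> = z t - (\<Sum>k<s. f (s - k))"
      using s lag [of _ 0] by (subst sum.union_disjoint) (auto simp: Phi0_def f_def t_def sum_negf)
    also have "(\<Sum>k<s. f (s - k)) = (\<Sum>i=1..s. f i)"
      by (rule sum.reindex_bij_witness [of _ "\<lambda>i. s - i" "\<lambda>k. s - k"]) auto
    finally show ?thesis .
  qed
  have Rn: "R (Suc n) = - (\<Sum>i=n * S + s + 1..Suc n * S + s. f i)" if "Suc n \<le> P_order S p" for n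
  proof -
    have "R (Suc n) = - (\<Sum>k<S. f (Suc n * S + s - k))"
      unfolding R_def sum_negf [symmetric]
      using that s lag [of _ "Suc n"]
      by (intro sum.cong refl) (auto simp: Phi_coeff_def Phi_def f_def)
    also have "(\<Sum>k<S. f (Suc n * S + s - k)) = (\<Sum>i=n * S + s + 1..Suc n * S + s. f i)"
      by (rule sum.reindex_bij_witness [of _ "\<lambda>i. Suc n * S + s - i" "\<lambda>k. Suc n * S + s - k"]) auto
    finally show ?thesis .
  qed
  have "(\<Sum>n\<le>N. R n) = z t - (\<Sum>i=1..N * S + s. f i)" if "N \<le> P_order S p" for N
    using that
  proof (induction N)
    case 0
    then show ?case by (simp add: R0)
  next
    case (Suc N)
    have "{1..Suc N * S + s} = {1..N * S + s} \<union> {N * S + s + 1..Suc N * S + s}" by auto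
    moreover have "{1..N * S + s} \<inter> {N * S + s + 1..Suc N * S + s} = {}" by auto
    ultimately have "(\<Sum>i=1..Suc N * S + s. f i) =
        (\<Sum>i=1..N * S + s. f i) + (\<Sum>i=N * S + s + 1..Suc N * S + s. f i)"
      by (simp only: sum.union_disjoint finite_atLeastAtMost)
    with Suc Rn [of N] show ?case by simp
  qed
  then have "(\<Sum>n\<le>P_order S p. R n) = z t - (\<Sum>i=1..P_order S p * S + s. f i)" by simp
  also have "(\<Sum>i=1..P_order S p * S + s. f i) = (\<Sum>i=1..p. f i)"
  proof (rule sum.mono_neutral_right)
    have "p + 1 < ((p + 1) div S + 1) * S"
      using S dividend_less_div_times [of S "p + 1"] by simp
    then have "p \<le> P_order S p * S + s" by (simp add: P_order_def)
    then show "{1..p} \<subseteq> {1..P_order S p * S + s}" by auto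
  qed (use zero in \<open>auto simp: f_def\<close>)
  also have "(\<Sum>i=1..p. f i) = (\<Sum>i=1..p. \<phi> t i * z (t - int i))"
    using periodic_shift [OF per, of \<tau> "int (s + 1)"] by (simp add: f_def t_def)
  finally show ?thesis by (simp add: R_def)
qed

text \<open>
  Insert the vector form of \<open>w\<close> into the series and sort by the total lag \<open>m = j + n\<close>: the coefficient of
  \<open>z\<close> at lag \<open>m\<close> is that of \<open>Pc(L) * \<Phi>(L)\<close>, which is \<open>1\<close> for \<open>m = 0\<close> and \<open>0\<close> otherwise because \<open>Pc\<close> is a
  left inverse.  Boundedness of \<open>z\<close> makes all the series converge absolutely.
\<close>
theorem AR_inversion:
  fixes z :: "int \<Rightarrow> real"
  assumes S: "S \<ge> 1" and per: "periodic S \<phi>" and zero: "\<forall>t i. i > p \<longrightarrow> \<phi> t i = 0"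
    and root: "\<forall>z::complex. Determinant.det (char_mat S p \<phi> z) = 0 \<longrightarrow> cmod z < 1"
    and Pc: "Phi_inverse_coeffs S p \<phi> Pc"
    and s: "s < S" and bounded: "\<And>t. \<bar>z t\<bar> \<le> B"
  defines "w \<equiv> \<lambda>t. z t - (\<Sum>i=1..p. \<phi> t i * z (t - int i))"
  shows "(\<lambda>j. \<Sum>l<S. Pc j $$ (s, l) * w (int S * (\<tau> - int j) + int (l + 1))) sums z (int S * \<tau> + int (s + 1))"
proof -
  let ?P = "P_order S p"
  define y where "y m k = z (int S * (\<tau> - int m) + int (k + 1))" for m k
  define X where "X n k l j = Pc j $$ (s, l) * Phi_coeff S p \<phi> n $$ (l, k) * y (j + n) k" for n k l j
  have X: "X n k l sums suminf (X n k l)" if "l < S" for n k l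
  proof (rule summable_sums, rule summable_comparison_test' [where N = 0])
    show "summable (\<lambda>j. (1 + real j) * \<bar>Pc j $$ (s, l)\<bar> * (\<bar>Phi_coeff S p \<phi> n $$ (l, k)\<bar> * B))"
      by (intro summable_mult2 inverse_coeffs_summable [OF root Pc s that])
    fix j
    have "\<bar>Pc j $$ (s, l)\<bar> \<le> (1 + real j) * \<bar>Pc j $$ (s, l)\<bar>"
      by (simp add: algebra_simps)
    then show "norm (X n k l j) \<le> (1 + real j) * \<bar>Pc j $$ (s, l)\<bar> * (\<bar>Phi_coeff S p \<phi> n $$ (l, k)\<bar> * B)"
      unfolding X_def y_def real_norm_def abs_mult mult.assoc [symmetric]
      by (intro mult_mono bounded mult_nonneg_nonneg) (auto simp: mult.assoc)
  qed
  have lhs: "(\<Sum>n\<le>?P. \<Sum>k<S. \<Sum>l<S. X n k l j) =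
      (\<Sum>l<S. Pc j $$ (s, l) * w (int S * (\<tau> - int j) + int (l + 1)))" for j
  proof -
    have "w (int S * (\<tau> - int j) + int (l + 1)) =
        (\<Sum>n\<le>?P. \<Sum>k<S. Phi_coeff S p \<phi> n $$ (l, k) * y (j + n) k)" if "l < S" for l
      unfolding w_def by (subst AR_vector_form [OF S per zero that]) (simp add: y_def algebra_simps)
    then have "(\<Sum>l<S. Pc j $$ (s, l) * w (int S * (\<tau> - int j) + int (l + 1))) =
        (\<Sum>l<S. \<Sum>n\<le>?P. \<Sum>k<S. X n k l j)"
      by (simp add: X_def sum_distrib_left mult.assoc)
    also have "\<dots> = (\<Sum>n\<le>?P. \<Sum>l<S. \<Sum>k<S. X n k l j)" by (rule sum.swap)
    also have "\<dots> = (\<Sum>n\<le>?P. \<Sum>k<S. \<Sum>l<S. X n k l j)" by (intro sum.cong refl sum.swap)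
    finally show ?thesis by simp
  qed
  have 1: "(\<lambda>j. \<Sum>l<S. Pc j $$ (s, l) * w (int S * (\<tau> - int j) + int (l + 1))) sums
      (\<Sum>n\<le>?P. \<Sum>k<S. \<Sum>l<S. suminf (X n k l))"
    unfolding lhs [symmetric] by (intro sums_sum X) auto
  (* X n k l moved to the total lag: the summand that was indexed by j now has index m = j + n. *)
  define Y where "Y n k l m = (if m < n then 0 else X n k l (m - n))" for n k l m
  have Y: "Y n k l sums suminf (X n k l)" if "l < S" for n k l
  proof -
    have "(\<lambda>i. Y n k l (i + n)) sums suminf (X n k l)"
      using X [OF that] by (simp add: Y_def)
    moreover have "\<forall>i<n. Y n k l i = 0" by (simp add: Y_def)
    ultimately show ?thesis
      using sums_zero_iff_shift [of n "Y n k l"] by blast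
  qed
  have rhs: "(\<Sum>n\<le>?P. \<Sum>k<S. \<Sum>l<S. Y n k l m) = (if m = 0 then y 0 s else 0)" for m
  proof -
    have Yz: "Y n k l m = 0" if "n \<notin> {..?P} \<inter> {..m}" "k < S" "l < S" for n k l
      using that by (auto simp: Y_def X_def Phi_coeff_def)
    have "(\<Sum>n\<le>?P. \<Sum>k<S. \<Sum>l<S. Y n k l m) = (\<Sum>n\<in>{..?P} \<inter> {..m}. \<Sum>k<S. \<Sum>l<S. Y n k l m)"
      by (intro sum.mono_neutral_right ballI sum.neutral Yz) auto
    also have "\<dots> = (\<Sum>n\<le>m. \<Sum>k<S. \<Sum>l<S. Y n k l m)"
      by (intro sum.mono_neutral_left ballI sum.neutral Yz) auto
    also have "\<dots> = (\<Sum>k<S. \<Sum>n\<le>m. \<Sum>l<S. Y n k l m)" by (rule sum.swap)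
    also have "\<dots> = (\<Sum>k<S. (\<Sum>n\<le>m. \<Sum>l<S. Pc (m - n) $$ (s, l) * Phi_coeff S p \<phi> n $$ (l, k)) * y m k)"
      by (simp add: Y_def X_def sum_distrib_right)
    also have "\<dots> = (\<Sum>k<S. (if m = 0 \<and> s = k then 1 else 0) * y m k)"
      by (intro sum.cong refl arg_cong2 [where f = "(*)"] inverse_coeffs_left [OF root Pc s]) auto
    also have "\<dots> = (if m = 0 then y 0 s else 0)"
      using s by (simp add: if_distrib [of "\<lambda>x. x * _"] cong: if_cong)
    finally show ?thesis .
  qed
  have "(\<lambda>m. if m = 0 then y 0 s else 0) sums (\<Sum>n\<le>?P. \<Sum>k<S. \<Sum>l<S. suminf (X n k l))"
    unfolding rhs [symmetric] by (intro sums_sum Y) auto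
  moreover have "(\<lambda>m. if m = 0 then y 0 s else 0) sums y 0 s"
    using sums_single [of 0 "\<lambda>_. y 0 s"] by simp
  ultimately have "(\<Sum>n\<le>?P. \<Sum>k<S. \<Sum>l<S. suminf (X n k l)) = y 0 s"
    by (rule sums_unique2)
  with 1 show ?thesis by (simp add: y_def)
qed

section \<open>Covariances of mean-square limits\<close>

lemma square_integrable_mult:
  assumes "square_integrable M X" "square_integrable M Y"
  shows "integrable M (\<lambda>\<omega>. X \<omega> * Y \<omega>)"
proof (rule Bochner_Integration.integrable_bound)
  show "integrable M (\<lambda>\<omega>. (X \<omega>)\<^sup>2 + (Y \<omega>)\<^sup>2)"
    using assms by (simp add: square_integrable_def)
  show "(\<lambda>\<omega>. X \<omega> * Y \<omega>) \<in> borel_measurable M"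
    using assms by (auto simp: square_integrable_def)
  have "\<bar>a * b\<bar> \<le> a\<^sup>2 + b\<^sup>2" for a b :: real
    using sum_squares_bound [of "\<bar>a\<bar>" "\<bar>b\<bar>"] by (simp add: abs_mult) (use mult_nonneg_nonneg [of "\<bar>a\<bar>" "\<bar>b\<bar>"] in linarith)
  then show "AE \<omega> in M. norm (X \<omega> * Y \<omega>) \<le> norm ((X \<omega>)\<^sup>2 + (Y \<omega>)\<^sup>2)"
    by simp
qed

lemma square_integrable_add:
  assumes "square_integrable M X" "square_integrable M Y"
  shows "square_integrable M (\<lambda>\<omega>. X \<omega> + Y \<omega>)"
  using assms square_integrable_mult [OF assms]
  by (auto simp: square_integrable_def power2_sum mult.assoc)

lemma square_integrable_cmult:
  assumes "square_integrable M X"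
  shows "square_integrable M (\<lambda>\<omega>. c * X \<omega>)"
  using assms by (auto simp: square_integrable_def power_mult_distrib)

lemma square_integrable_diff:
  assumes "square_integrable M X" "square_integrable M Y"
  shows "square_integrable M (\<lambda>\<omega>. X \<omega> - Y \<omega>)"
  using square_integrable_add [OF assms(1) square_integrable_cmult [OF assms(2), of "-1"]] by simp

lemma square_integrable_sum:
  assumes "\<And>i. i \<in> I \<Longrightarrow> square_integrable M (X i)"
  shows "square_integrable M (\<lambda>\<omega>. \<Sum>i\<in>I. X i \<omega>)"
  using assms
  by (induction I rule: infinite_finite_induct)
    (simp_all add: square_integrable_add, simp_all add: square_integrable_def)

context prob_space
begin

lemma square_integrable_integrable:
  assumes "square_integrable M X"
  shows "integrable M X"
  using assms by (auto simp: square_integrable_def intro: square_integrable_imp_integrable)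

lemma covariance_eq:
  assumes "square_integrable M X" "square_integrable M Y"
  shows "covariance M X Y = (LINT \<omega>|M. X \<omega> * Y \<omega>) - (LINT \<omega>|M. X \<omega>) * (LINT \<omega>|M. Y \<omega>)"
proof -
  note i = square_integrable_mult [OF assms] assms [THEN square_integrable_integrable]
  have "covariance M X Y = (LINT \<omega>|M. X \<omega> * Y \<omega> - (LINT x|M. Y x) * X \<omega>
      - (LINT x|M. X x) * Y \<omega> + (LINT x|M. X x) * (LINT x|M. Y x))"
    unfolding covariance_def by (simp add: algebra_simps)
  also have "\<dots> = (LINT \<omega>|M. X \<omega> * Y \<omega>) - (LINT \<omega>|M. X \<omega>) * (LINT \<omega>|M. Y \<omega>)"
    using i by (simp add: prob_space mult.commute)
  finally show ?thesis .
qed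

lemma covariance_commute: "covariance M X Y = covariance M Y X"
  by (simp add: covariance_def mult.commute)

lemma covariance_add:
  assumes "square_integrable M X" "square_integrable M X'" "square_integrable M Y"
  shows "covariance M (\<lambda>\<omega>. X \<omega> + X' \<omega>) Y = covariance M X Y + covariance M X' Y"
  using assms square_integrable_mult [OF assms(1,3)] square_integrable_mult [OF assms(2,3)]
  by (simp add: covariance_eq square_integrable_add square_integrable_integrable ring_distribs)

lemma covariance_cmult:
  assumes "square_integrable M X" "square_integrable M Y"
  shows "covariance M (\<lambda>\<omega>. c * X \<omega>) Y = c * covariance M X Y"
  using assms by (simp add: covariance_eq square_integrable_cmult right_diff_distrib mult.assoc)

lemma covariance_cmult2:
  assumes "square_integrable M X" "square_integrable M Y"
  shows "covariance M (\<lambda>\<omega>. a * X \<omega>) (\<lambda>\<omega>. b * Y \<omega>) = a * b * covariance M X Y"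
proof -
  have "covariance M (\<lambda>\<omega>. a * X \<omega>) (\<lambda>\<omega>. b * Y \<omega>) = a * covariance M (\<lambda>\<omega>. b * Y \<omega>) X"
    by (simp only: covariance_cmult square_integrable_cmult assms covariance_commute [of X])
  also have "covariance M (\<lambda>\<omega>. b * Y \<omega>) X = b * covariance M X Y"
    by (simp only: covariance_cmult assms covariance_commute [of X])
  finally show ?thesis by simp
qed

lemma covariance_diff:
  assumes "square_integrable M X" "square_integrable M X'" "square_integrable M Y"
  shows "covariance M (\<lambda>\<omega>. X \<omega> - X' \<omega>) Y = covariance M X Y - covariance M X' Y"
  using covariance_add [OF assms(1) square_integrable_cmult [OF assms(2), of "-1"] assms(3)]
    covariance_cmult [OF assms(2,3), of "-1"] by simp

lemma covariance_sum:
  assumes "\<And>i. i \<in> I \<Longrightarrow> square_integrable M (X i)" "square_integrable M Y"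
  shows "covariance M (\<lambda>\<omega>. \<Sum>i\<in>I. X i \<omega>) Y = (\<Sum>i\<in>I. covariance M (X i) Y)"
  using assms
  by (induction I rule: infinite_finite_induct)
    (simp_all add: covariance_add square_integrable_sum, simp_all add: covariance_def)

lemma covariance_self_nonneg: "covariance M X X \<ge> 0"
  by (simp add: covariance_def)

lemma covariance_self_le:
  assumes "square_integrable M X"
  shows "covariance M X X \<le> (LINT \<omega>|M. (X \<omega>)\<^sup>2)"
  using assms by (simp add: covariance_eq power2_eq_square)

text \<open>
  The variance of \<open>X - t * Y\<close> is a nonnegative quadratic polynomial in \<open>t\<close>.
\<close>
lemma covariance_Cauchy_Schwarz:
  assumes X: "square_integrable M X" and Y: "square_integrable M Y"
  shows "\<bar>covariance M X Y\<bar> \<le> sqrt (covariance M X X) * sqrt (covariance M Y Y)"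
proof -
  define a b c where "a = covariance M X X" and "b = covariance M Y Y" and "c = covariance M X Y"
  have quad: "0 \<le> a - 2 * t * c + t\<^sup>2 * b" for t
  proof -
    let ?tY = "\<lambda>\<omega>. t * Y \<omega>" and ?D = "\<lambda>\<omega>. X \<omega> - t * Y \<omega>"
    have tY: "square_integrable M ?tY" by (rule square_integrable_cmult [OF Y])
    have D: "square_integrable M ?D" by (rule square_integrable_diff [OF X tY])
    have "covariance M ?D ?D = covariance M ?D X - t * covariance M ?D Y"
      using covariance_diff [OF X tY D] covariance_cmult [OF Y D, of t] by (simp add: covariance_commute)
    also have "covariance M ?D X = a - t * c"
      using covariance_diff [OF X tY X] covariance_cmult [OF Y X, of t]
      by (simp add: covariance_commute a_def c_def)
    also have "covariance M ?D Y = c - t * b"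
      using covariance_diff [OF X tY Y] covariance_cmult [OF Y Y, of t] by (simp add: b_def c_def)
    finally show ?thesis
      using covariance_self_nonneg [of ?D] by (simp add: algebra_simps power2_eq_square)
  qed
  have "a \<ge> 0" "b \<ge> 0" by (simp_all add: a_def b_def covariance_self_nonneg)
  have "c\<^sup>2 \<le> a * b"
  proof (cases "b = 0")
    case True
    have "c = 0"
    proof (rule ccontr)
      assume "c \<noteq> 0"
      then show False using quad [of "(a + 1) / (2 * c)"] True by simp
    qed
    then show ?thesis using True by simp
  next
    case False
    then have "b > 0" using \<open>b \<ge> 0\<close> by simp
    then show ?thesis using quad [of "c / b"] by (simp add: field_simps power2_eq_square)
  qed
  then have "sqrt (c\<^sup>2) \<le> sqrt (a * b)" by (rule real_sqrt_le_mono)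
  then show ?thesis by (simp add: a_def b_def c_def real_sqrt_mult)
qed

text \<open>
  The covariance is bilinear and, by Cauchy-Schwarz, continuous in mean square.
\<close>
lemma covariance_ms_limit:
  assumes X: "ms_sums M X X'" and Y: "ms_sums M Y Y'"
  shows "(\<lambda>n. \<Sum>j<n. \<Sum>k<n. covariance M (X j) (Y k)) \<longlonglongrightarrow> covariance M X' Y'"
proof -
  define U where "U n \<omega> = (\<Sum>j<n. X j \<omega>)" for n \<omega>
  define V where "V n \<omega> = (\<Sum>j<n. Y j \<omega>)" for n \<omega>
  have L: "square_integrable M (X j)" "square_integrable M (Y j)" "square_integrable M X'" "square_integrable M Y'" for j
    using X Y by (auto simp: ms_sums_def)
  have U: "square_integrable M (U n)" and V: "square_integrable M (V n)" for n
    unfolding U_def V_def by (intro square_integrable_sum L)+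
  have dU: "square_integrable M (\<lambda>\<omega>. U n \<omega> - X' \<omega>)" and dV: "square_integrable M (\<lambda>\<omega>. V n \<omega> - Y' \<omega>)" for n
    by (intro square_integrable_diff U V L)+
  define d where "d n = sqrt (LINT \<omega>|M. (U n \<omega> - X' \<omega>)\<^sup>2)" for n
  define e where "e n = sqrt (LINT \<omega>|M. (V n \<omega> - Y' \<omega>)\<^sup>2)" for n
  have "(\<lambda>n. LINT \<omega>|M. (U n \<omega> - X' \<omega>)\<^sup>2) \<longlonglongrightarrow> 0"
    using X by (simp add: ms_sums_def U_def)
  from tendsto_real_sqrt [OF this] have d_lim: "d \<longlonglongrightarrow> 0"
    by (simp add: d_def [abs_def])
  have "(\<lambda>n. LINT \<omega>|M. (V n \<omega> - Y' \<omega>)\<^sup>2) \<longlonglongrightarrow> 0"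
    using Y by (simp add: ms_sums_def V_def)
  from tendsto_real_sqrt [OF this] have e_lim: "e \<longlonglongrightarrow> 0"
    by (simp add: e_def [abs_def])
  define x y where "x = sqrt (covariance M X' X')" and "y = sqrt (covariance M Y' Y')"
  have eq: "covariance M (U n) (V n) - covariance M X' Y' =
      covariance M (\<lambda>\<omega>. U n \<omega> - X' \<omega>) (\<lambda>\<omega>. V n \<omega> - Y' \<omega>) +
      covariance M (\<lambda>\<omega>. U n \<omega> - X' \<omega>) Y' + covariance M X' (\<lambda>\<omega>. V n \<omega> - Y' \<omega>)" for n
  proof -
    have "covariance M (\<lambda>\<omega>. U n \<omega> - X' \<omega>) (\<lambda>\<omega>. V n \<omega> - Y' \<omega>) =
        covariance M (U n) (\<lambda>\<omega>. V n \<omega> - Y' \<omega>) - covariance M X' (\<lambda>\<omega>. V n \<omega> - Y' \<omega>)"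
      by (intro covariance_diff U L dV)
    moreover have "covariance M (U n) (\<lambda>\<omega>. V n \<omega> - Y' \<omega>) = covariance M (U n) (V n) - covariance M (U n) Y'"
      using covariance_diff [OF V L(4) U, of n n] by (simp add: covariance_commute)
    moreover have "covariance M (\<lambda>\<omega>. U n \<omega> - X' \<omega>) Y' = covariance M (U n) Y' - covariance M X' Y'"
      by (intro covariance_diff U L)
    ultimately show ?thesis by simp
  qed
  have bound: "\<bar>covariance M (U n) (V n) - covariance M X' Y'\<bar> \<le> d n * e n + d n * y + x * e n" for n
  proof -
    have d: "sqrt (covariance M (\<lambda>\<omega>. U n \<omega> - X' \<omega>) (\<lambda>\<omega>. U n \<omega> - X' \<omega>)) \<le> d n"
      unfolding d_def by (intro real_sqrt_le_mono covariance_self_le dU)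
    have e: "sqrt (covariance M (\<lambda>\<omega>. V n \<omega> - Y' \<omega>) (\<lambda>\<omega>. V n \<omega> - Y' \<omega>)) \<le> e n"
      unfolding e_def by (intro real_sqrt_le_mono covariance_self_le dV)
    have 0: "0 \<le> d n" "0 \<le> e n" "0 \<le> x" "0 \<le> y"
      by (simp_all add: d_def e_def x_def y_def covariance_self_nonneg)
    have "\<bar>covariance M (\<lambda>\<omega>. U n \<omega> - X' \<omega>) (\<lambda>\<omega>. V n \<omega> - Y' \<omega>)\<bar> \<le> d n * e n"
      by (rule order_trans [OF covariance_Cauchy_Schwarz [OF dU dV] mult_mono [OF d e 0(1)]])
        (simp add: covariance_self_nonneg)
    moreover have "\<bar>covariance M (\<lambda>\<omega>. U n \<omega> - X' \<omega>) Y'\<bar> \<le> d n * y"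
      using covariance_Cauchy_Schwarz [OF dU L(4)] mult_right_mono [OF d 0(4)]
      unfolding y_def by (rule order_trans)
    moreover have "\<bar>covariance M X' (\<lambda>\<omega>. V n \<omega> - Y' \<omega>)\<bar> \<le> x * e n"
      using covariance_Cauchy_Schwarz [OF L(3) dV] mult_left_mono [OF e 0(3)]
      unfolding x_def by (rule order_trans)
    ultimately show ?thesis unfolding eq by linarith
  qed
  have "(\<lambda>n. d n * e n + d n * y + x * e n) \<longlonglongrightarrow> 0 * 0 + 0 * y + x * 0"
    by (intro tendsto_intros d_lim e_lim)
  then have bound_lim: "(\<lambda>n. d n * e n + d n * y + x * e n) \<longlonglongrightarrow> 0" by simp
  have "(\<lambda>n. covariance M (U n) (V n) - covariance M X' Y') \<longlonglongrightarrow> 0"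
    by (rule Lim_null_comparison [OF _ bound_lim]) (simp add: bound)
  then have "(\<lambda>n. covariance M (U n) (V n)) \<longlonglongrightarrow> covariance M X' Y'"
    by (simp add: LIM_zero_iff)
  moreover have "covariance M (U n) (V n) = (\<Sum>j<n. \<Sum>k<n. covariance M (X j) (Y k))" for n
  proof -
    have "covariance M (U n) (V n) = (\<Sum>j<n. covariance M (X j) (V n))"
      unfolding U_def by (intro covariance_sum L V)
    also have "\<dots> = (\<Sum>j<n. \<Sum>k<n. covariance M (X j) (Y k))"
    proof (intro sum.cong refl)
      fix j
      have "covariance M (V n) (X j) = (\<Sum>k<n. covariance M (Y k) (X j))"
        unfolding V_def by (intro covariance_sum L)
      then show "covariance M (X j) (V n) = (\<Sum>k<n. covariance M (X j) (Y k))"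
        by (simp add: covariance_commute)
    qed
    finally show ?thesis .
  qed
  ultimately show ?thesis by simp
qed

text \<open>
  Expanding both series, only innovations with equal time index contribute, that is \<open>k = j + m\<close>.
\<close>
lemma frac_noise_covariance:
  assumes u: "white_noise M u \<sigma>" and D: "0 \<le> D" "D < 1 / 2" and S: "S \<ge> 1"
    and W: "ms_sums M (\<lambda>j \<omega>. frac_coeff D j * u (t - int S * int j) \<omega>) W"
    and W': "ms_sums M (\<lambda>j \<omega>. frac_coeff D j * u (t + int S * int m - int S * int j) \<omega>) W'"
    and per: "periodic S (\<lambda>t. (\<sigma> t)\<^sup>2)"
  shows "covariance M W W' = (\<sigma> t)\<^sup>2 * frac_acv D m"
proof -
  let ?c = "frac_coeff D"
  have L: "square_integrable M (u t)" and var: "covariance M (u t) (u t) = (\<sigma> t)\<^sup>2" for t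
    using u unfolding white_noise_def by blast+
  have uncorr: "covariance M (u t) (u r) = 0" if "t \<noteq> r" for t r
    using u that unfolding white_noise_def by blast
  have cov: "covariance M (u (t - int S * int j)) (u (t + int S * int m - int S * int k)) =
      (if k = j + m then (\<sigma> t)\<^sup>2 else 0)" for j k
  proof (cases "k = j + m")
    case True
    have "(\<sigma> (t - int S * int j))\<^sup>2 = (\<sigma> t)\<^sup>2"
      using periodic_shift [OF per, of "- int j" t] by simp
    moreover have "t + int S * int m - int S * int k = t - int S * int j"
      unfolding True of_nat_add distrib_left by linarith
    ultimately show ?thesis
      using True by (simp only: var refl if_True)
  next
    case False
    have "t - int S * int j \<noteq> t + int S * int m - int S * int k"
    proof
      assume "t - int S * int j = t + int S * int m - int S * int k"
      then have "int S * int k = int S * int (j + m)"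
        unfolding of_nat_add distrib_left by linarith
      then show False using S False by simp
    qed
    from uncorr [OF this] show ?thesis using False by simp
  qed
  have scaled: "covariance M (\<lambda>\<omega>. ?c j * u (t - int S * int j) \<omega>)
      (\<lambda>\<omega>. ?c k * u (t + int S * int m - int S * int k) \<omega>) =
      (if k = j + m then (\<sigma> t)\<^sup>2 * (?c j * ?c (j + m)) else 0)" for j k
    by (simp add: covariance_cmult2 [OF L L] cov)
  have partial: "(\<Sum>j<n + m. \<Sum>k<n + m. if k = j + m then (\<sigma> t)\<^sup>2 * (?c j * ?c (j + m)) else 0) =
      (\<sigma> t)\<^sup>2 * (\<Sum>j<n. ?c j * ?c (j + m))" for n
  proof -
    have "(\<Sum>j<n + m. \<Sum>k<n + m. if k = j + m then (\<sigma> t)\<^sup>2 * (?c j * ?c (j + m)) else 0) =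
        (\<Sum>j<n + m. if j < n then (\<sigma> t)\<^sup>2 * (?c j * ?c (j + m)) else 0)"
      by (intro sum.cong refl) auto
    also have "\<dots> = (\<Sum>j<n. (\<sigma> t)\<^sup>2 * (?c j * ?c (j + m)))"
      by (rule sum.mono_neutral_cong_right) auto
    finally show ?thesis by (simp add: sum_distrib_left)
  qed
  have "(\<lambda>n. \<Sum>j<n + m. \<Sum>k<n + m. if k = j + m then (\<sigma> t)\<^sup>2 * (?c j * ?c (j + m)) else 0)
      \<longlonglongrightarrow> covariance M W W'"
    using LIMSEQ_ignore_initial_segment [OF covariance_ms_limit [OF W W'], of m] by (simp only: scaled)
  then have "(\<lambda>n. (\<sigma> t)\<^sup>2 * (\<Sum>j<n. ?c j * ?c (j + m))) \<longlonglongrightarrow> covariance M W W'"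
    by (simp only: partial)
  moreover have "(\<lambda>n. (\<sigma> t)\<^sup>2 * (\<Sum>j<n. ?c j * ?c (j + m))) \<longlonglongrightarrow> (\<sigma> t)\<^sup>2 * frac_acv D m"
    using frac_acv_sums [OF D, of m] unfolding sums_def by (rule tendsto_mult_left)
  ultimately show ?thesis by (rule LIMSEQ_unique)
qed

text \<open>
  The two series involve innovations from different residue classes modulo \<open>S\<close>.
\<close>
lemma frac_noise_uncorrelated:
  assumes u: "white_noise M u \<sigma>" and ne: "\<not> int S dvd t' - t"
    and W: "ms_sums M (\<lambda>j \<omega>. frac_coeff D j * u (t - int S * int j) \<omega>) W"
    and W': "ms_sums M (\<lambda>j \<omega>. frac_coeff D' j * u (t' - int S * int j) \<omega>) W'"
  shows "covariance M W W' = 0"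
proof -
  have L: "square_integrable M (u t)" for t using u by (simp add: white_noise_def)
  have "covariance M (\<lambda>\<omega>. frac_coeff D j * u (t - int S * int j) \<omega>)
      (\<lambda>\<omega>. frac_coeff D' k * u (t' - int S * int k) \<omega>) = 0" for j k
  proof -
    have "t - int S * int j \<noteq> t' - int S * int k"
    proof
      assume "t - int S * int j = t' - int S * int k"
      then have "t' - t = int S * (int k - int j)"
        unfolding right_diff_distrib by linarith
      with ne show False by (metis dvd_triv_left)
    qed
    then have "covariance M (u (t - int S * int j)) (u (t' - int S * int k)) = 0"
      using u unfolding white_noise_def by blast
    then show ?thesis
      by (simp add: covariance_cmult2 [OF L L])
  qed
  then have "(\<lambda>n. 0) \<longlonglongrightarrow> covariance M W W'"
    using covariance_ms_limit [OF W W'] by simp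
  then show ?thesis by (simp add: LIMSEQ_const_iff)
qed

end

section \<open>The asymptotic formula\<close>

theorem corollary5:
  fixes M :: "'a measure"
    and u Z :: "int \<Rightarrow> 'a \<Rightarrow> real"
    and \<sigma> D :: "int \<Rightarrow> real"
    and \<phi> :: "int \<Rightarrow> nat \<Rightarrow> real"
    and S p :: nat
    and Pc :: "nat \<Rightarrow> real mat"
    and Pi :: "real mat"
    and D_max :: real
    and F1 :: "nat set"
  assumes "prob_space M"
    and "S \<ge> 1" and "p \<ge> 1"
    and "white_noise M u \<sigma>" and "periodic S (\<lambda>t. (\<sigma> t)\<^sup>2)"
    and "periodic S D" and "\<forall>s\<in>{1..S}. 0 \<le> D (int s) \<and> D (int s) < 1 / 2"
    and "periodic S \<phi>" and "\<forall>t i. i > p \<longrightarrow> \<phi> t i = 0"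
    and "\<forall>z::complex. Determinant.det (char_mat S p \<phi> z) = 0 \<longrightarrow> cmod z < 1"
    and "periodically_stationary M S Z"
    and "pfar_equation M S p \<phi> D u Z"
    and "Phi_inverse_coeffs S p \<phi> Pc"
    and "Pi = inv_mat (Phi_one S p \<phi>)"
    and "D_max = (MAX s\<in>{1..S}. D (int s))"
    and "F1 = {i \<in> {1..S}. D (int i) = D_max}"
  shows "invertible_mat (Phi_one S p \<phi>) \<and>
    (\<forall>l\<in>{1..S}. \<forall>i\<in>{1..S}. (\<lambda>j. Pc j $$ (l - 1, i - 1)) sums (Pi $$ (l - 1, i - 1))) \<and>
    (\<forall>s\<in>{1..S}. \<forall>\<nu>\<in>{0..S - 1}. \<forall>\<delta>. \<delta> = (if s + \<nu> \<le> S then 0 else 1) \<longrightarrow>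
      (\<forall>\<tau>::int.
        (\<lambda>h::nat. covariance M (Z (int S * \<tau> + int s)) (Z (int S * \<tau> + int s + int (h * S + \<nu>)))
                   / real (h + \<delta>) powr (2 * D_max - 1))
        \<longlonglongrightarrow> Gamma (1 - 2 * D_max) / (Gamma D_max * Gamma (1 - D_max)) *
          (\<Sum>i\<in>F1. Pi $$ (s - 1, i - 1) * Pi $$ (s + \<nu> - S * \<delta> - 1, i - 1) * (\<sigma> (int i))\<^sup>2)))"
proof -
  interpret prob_space M by (rule assms(1))
  note S = assms(2) and noise = assms(4) and per_\<sigma> = assms(5) and per_D = assms(6)
    and D_range = assms(7) and per_\<phi> = assms(8) and zero = assms(9) and root = assms(10)
    and stat = assms(11) and model = assms(12) and Pc = assms(13)
  let ?P = "\<lambda>j s l. Pc j $$ (s, l)"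
  (* The right-hand side of the model equation. *)
  define W where "W t \<omega> = Z t \<omega> - (\<Sum>i=1..p. \<phi> t i * Z (t - int i) \<omega>)" for t \<omega>
  have W_ms: "ms_sums M (\<lambda>j \<omega>. frac_coeff (D t) j * u (t - int S * int j) \<omega>) (W t)" for t
    using model by (simp add: pfar_equation_def W_def [abs_def])
  have LZ: "square_integrable M (Z t)" for t
    using stat by (simp add: periodically_stationary_def)
  have LW: "square_integrable M (W t)" for t
    using W_ms by (simp add: ms_sums_def)

  (* Seasons are numbered from 0, like the matrix indices: season l sits at the times S * \<tau> + l + 1. *)
  define d where "d l = D (int (l + 1))" for l
  have d: "0 \<le> d l" "d l < 1 / 2" if "l < S" for l
    using bspec [OF D_range, of "l + 1"] that by (simp_all add: d_def)
  define v where "v l = (\<sigma> (int (l + 1)))\<^sup>2" for l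
  have time: "D (int S * \<tau> + int (l + 1)) = d l" "(\<sigma> (int S * \<tau> + int (l + 1)))\<^sup>2 = v l" for \<tau> l
    unfolding d_def v_def by (rule periodic_shift [OF per_D], rule periodic_shift [OF per_\<sigma>])

  (* By symmetry it suffices to move forward in time. *)
  have covW_same: "covariance M (W (int S * \<tau> + int (l + 1))) (W (int S * \<tau>' + int (l + 1))) =
      v l * frac_acv (d l) (nat \<bar>\<tau>' - \<tau>\<bar>)" if l: "l < S" for \<tau> \<tau>' l
  proof -
    have *: "covariance M (W (int S * \<tau> + int (l + 1))) (W (int S * \<tau>' + int (l + 1))) =
        v l * frac_acv (d l) m" if "\<tau>' = \<tau> + int m" for \<tau> \<tau>' m
    proof -
      define t where "t = int S * \<tau> + int (l + 1)"
      have t': "int S * \<tau>' + int (l + 1) = t + int S * int m"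
        using that by (simp add: t_def distrib_left)
      have "D (t + int S * int m) = d l"
        using time(1) [of \<tau>' l] by (simp only: t')
      then have "covariance M (W t) (W (t + int S * int m)) = (\<sigma> t)\<^sup>2 * frac_acv (d l) m"
        using W_ms [of t] W_ms [of "t + int S * int m"] time(1) [of \<tau> l]
        by (intro frac_noise_covariance [OF noise d [OF l] S _ _ per_\<sigma>]) (simp_all add: t_def)
      then show ?thesis
        unfolding t' using time(2) [of \<tau> l] by (simp add: t_def)
    qed
    show ?thesis
    proof (cases "\<tau> \<le> \<tau>'")
      case True
      then show ?thesis using * [of \<tau>' \<tau> "nat \<bar>\<tau>' - \<tau>\<bar>"] by simp
    next
      case False
      then show ?thesis
        using * [of \<tau> \<tau>' "nat \<bar>\<tau>' - \<tau>\<bar>"] by (simp add: covariance_commute)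
    qed
  qed
  have covW_diff: "covariance M (W (int S * \<tau> + int (l + 1))) (W (int S * \<tau>' + int (l' + 1))) = 0"
    if "l < S" "l' < S" "l \<noteq> l'" for \<tau> \<tau>' l l'
  proof (rule frac_noise_uncorrelated [OF noise _ W_ms W_ms])
    have "(int S * \<tau>' + int (l' + 1) - (int S * \<tau> + int (l + 1))) = int S * (\<tau>' - \<tau>) + (int l' - int l)"
      by (simp add: algebra_simps)
    moreover have "\<not> int S dvd int l' - int l"
      using that zdvd_not_zless [of "\<bar>int l' - int l\<bar>" "int S"] by auto
    ultimately show "\<not> int S dvd (int S * \<tau>' + int (l' + 1)) - (int S * \<tau> + int (l + 1))"
      by (metis dvd_add_right_iff dvd_triv_left)
  qed

  have Z_bounded: "\<exists>B. \<forall>t. \<bar>covariance M (Z t) Y\<bar> \<le> B" if Y: "square_integrable M Y" for Y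
  proof -
    have per: "periodic S (\<lambda>t. covariance M (Z t) (Z t))"
      using stat by (simp add: periodically_stationary_def periodic_def)
    (* A periodic sequence takes finitely many values, so the variances of Z are bounded. *)
    define V where "V = Max ((\<lambda>t. covariance M (Z t) (Z t)) ` {0..int S})"
    have V: "covariance M (Z t) (Z t) \<le> V" for t
    proof -
      have "covariance M (Z t) (Z t) = covariance M (Z (t mod int S)) (Z (t mod int S))"
        using periodic_shift [OF per, of "t div int S" "t mod int S"] by simp
      also have "\<dots> \<le> V"
        unfolding V_def using S by (intro Max_ge finite_imageI imageI) (auto simp: less_imp_le)
      finally show ?thesis .
    qed
    have "\<bar>covariance M (Z t) Y\<bar> \<le> sqrt V * sqrt (covariance M Y Y)" for t
      by (rule order_trans [OF covariance_Cauchy_Schwarz [OF LZ Y]])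
        (intro mult_right_mono real_sqrt_le_mono V; simp add: covariance_self_nonneg)
    then show ?thesis by blast
  qed
  (* The autoregression acts on t \<mapsto> covariance M (Z t) Y by linearity, so AR_inversion recovers this
     sequence from t \<mapsto> covariance M (W t) Y. *)
  have expand: "(\<lambda>j. \<Sum>l<S. ?P j s l * covariance M (W (int S * (\<tau> - int j) + int (l + 1))) Y)
      sums covariance M (Z (int S * \<tau> + int (s + 1))) Y"
    if s: "s < S" and Y: "square_integrable M Y" for s Y \<tau>
  proof -
    have W: "covariance M (W t) Y = covariance M (Z t) Y - (\<Sum>i=1..p. \<phi> t i * covariance M (Z (t - int i)) Y)" for t
    proof -
      have "covariance M (W t) Y =
          covariance M (Z t) Y - covariance M (\<lambda>\<omega>. \<Sum>i=1..p. \<phi> t i * Z (t - int i) \<omega>) Y"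
        unfolding W_def by (intro covariance_diff LZ Y square_integrable_sum square_integrable_cmult)
      also have "covariance M (\<lambda>\<omega>. \<Sum>i=1..p. \<phi> t i * Z (t - int i) \<omega>) Y =
          (\<Sum>i=1..p. covariance M (\<lambda>\<omega>. \<phi> t i * Z (t - int i) \<omega>) Y)"
        by (intro covariance_sum LZ Y square_integrable_cmult)
      finally show ?thesis by (simp add: covariance_cmult LZ Y)
    qed
    obtain B where "\<And>t. \<bar>covariance M (Z t) Y\<bar> \<le> B" using Z_bounded [OF Y] by blast
    from AR_inversion [OF S per_\<phi> zero root Pc s, of "\<lambda>t. covariance M (Z t) Y", OF this]
    show ?thesis by (simp add: W)
  qed

  define \<beta> where "\<beta> = 1 - 2 * D_max"
  have D_max_ge: "d l \<le> D_max" if "l < S" for l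
    unfolding d_def assms(15) using that by (intro Max_ge imageI) auto
  have "D_max \<in> (\<lambda>s. D (int s)) ` {1..S}"
    unfolding assms(15) using S by (intro Max_in) auto
  then have D_max: "0 \<le> D_max" "D_max < 1 / 2" using D_range by auto
  then have \<beta>: "0 \<le> \<beta>" "\<beta> \<le> 1" by (simp_all add: \<beta>_def)
  define K where "K = Gamma (1 - 2 * D_max) / (Gamma D_max * Gamma (1 - D_max))"
  define L where "L l = (if d l = D_max then K * v l else 0)" for l
  define g where "g l h = v l * frac_acv (d l) h" for l h
  (* A season with d l < D_max decays faster than the normalisation, by the factor (1 + h) powr (2 * d l - 2 * D_max). *)
  have g_lim: "(\<lambda>h. g l h * (1 + real h) powr \<beta>) \<longlonglongrightarrow> L l" if l: "l < S" for l
  proof (cases "d l = D_max")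
    case True
    then show ?thesis
      using tendsto_mult_left [OF frac_acv_asymp [OF d [OF l]], of "v l"]
      by (simp add: g_def L_def K_def \<beta>_def mult_ac)
  next
    case False
    then have "d l < D_max" using D_max_ge [OF l] by simp
    then have "((\<lambda>h. (1 + real h) powr (2 * d l - 2 * D_max)) \<longlongrightarrow> 0) sequentially"
      by (intro tendsto_neg_powr filterlim_tendsto_add_at_top [OF tendsto_const] filterlim_real_sequentially) simp
    from tendsto_mult [OF tendsto_mult_left [OF frac_acv_asymp [OF d [OF l]], of "v l"] this]
    have "(\<lambda>h. v l * (frac_acv (d l) h * (1 + real h) powr (1 - 2 * d l)) *
        (1 + real h) powr (2 * d l - 2 * D_max)) \<longlonglongrightarrow> 0" by simp
    moreover have "v l * (frac_acv (d l) h * (1 + real h) powr (1 - 2 * d l)) *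
        (1 + real h) powr (2 * d l - 2 * D_max) = g l h * (1 + real h) powr \<beta>" for h
      by (simp add: g_def \<beta>_def powr_add [symmetric] mult.assoc)
    ultimately show ?thesis using False by (simp add: L_def)
  qed

  have sums_Pi: "(\<lambda>j. ?P j s k) sums (Pi $$ (s, k))" if "s < S" "k < S" for s k
    unfolding assms(14) by (rule Phi_one_inverse(2) [OF root Pc that])

  have main: "(\<lambda>H. covariance M (Z (int S * \<tau> + int (s + 1))) (Z (int S * (\<tau> + int H) + int (r + 1))) *
      (1 + real H) powr \<beta>) \<longlonglongrightarrow> (\<Sum>l<S. L l * Pi $$ (s, l) * Pi $$ (r, l))"
    if s: "s < S" and r: "r < S" for s r \<tau>
  proof -
    define T where "T l H n = (\<Sum>m. ?P m r l * g l (nat \<bar>int H + int n - int m\<bar>))" for l H n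
    note filt = filtered_acv_asymp [OF inverse_coeffs_summable [OF root Pc s]
        inverse_coeffs_summable [OF root Pc r] \<beta> g_lim]
    (* Second inversion: among the noise variables in the expansion of Z, only those of season l are
       correlated with W in season l. *)
    have inner: "covariance M (W (int S * (\<tau> - int n) + int (l + 1))) (Z (int S * (\<tau> + int H) + int (r + 1))) = T l H n"
      if l: "l < S" for l n H
    proof -
      have "(\<lambda>m. ?P m r l * g l (nat \<bar>int H + int n - int m\<bar>)) sums
          covariance M (Z (int S * (\<tau> + int H) + int (r + 1))) (W (int S * (\<tau> - int n) + int (l + 1)))"
      proof (rule sums_cong [THEN iffD1, OF _ expand [OF r LW]])
        fix m
        have "(\<Sum>l'<S. ?P m r l' * covariance M (W (int S * (\<tau> + int H - int m) + int (l' + 1)))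
              (W (int S * (\<tau> - int n) + int (l + 1)))) =
            (\<Sum>l'<S. if l' = l then ?P m r l * g l (nat \<bar>int H + int n - int m\<bar>) else 0)"
        proof (intro sum.cong refl)
          fix l' assume "l' \<in> {..<S}"
          moreover have "nat \<bar>(\<tau> - int n) - (\<tau> + int H - int m)\<bar> = nat \<bar>int H + int n - int m\<bar>"
            by linarith
          ultimately show "?P m r l' * covariance M (W (int S * (\<tau> + int H - int m) + int (l' + 1)))
              (W (int S * (\<tau> - int n) + int (l + 1))) =
              (if l' = l then ?P m r l * g l (nat \<bar>int H + int n - int m\<bar>) else 0)"
            using covW_same [OF l, of "\<tau> + int H - int m" "\<tau> - int n"]
              covW_diff [of l' l "\<tau> + int H - int m" "\<tau> - int n"] l
            by (cases "l' = l") (simp_all add: g_def)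
        qed
        then show "(\<Sum>l'<S. ?P m r l' * covariance M (W (int S * (\<tau> + int H - int m) + int (l' + 1)))
              (W (int S * (\<tau> - int n) + int (l + 1)))) = ?P m r l * g l (nat \<bar>int H + int n - int m\<bar>)"
          using l by simp
      qed
      then show ?thesis
        unfolding T_def by (simp add: sums_iff covariance_commute)
    qed
    have "covariance M (Z (int S * \<tau> + int (s + 1))) (Z (int S * (\<tau> + int H) + int (r + 1))) =
        (\<Sum>l<S. \<Sum>n. ?P n s l * T l H n)" for H
    proof -
      have "(\<lambda>n. \<Sum>l<S. ?P n s l * T l H n) sums
          covariance M (Z (int S * \<tau> + int (s + 1))) (Z (int S * (\<tau> + int H) + int (r + 1)))"
        by (rule sums_cong [THEN iffD1, OF _ expand [OF s LZ]])
          (intro sum.cong refl, simp only: inner lessThan_iff)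
      moreover have "(\<lambda>n. \<Sum>l<S. ?P n s l * T l H n) sums (\<Sum>l<S. \<Sum>n. ?P n s l * T l H n)"
        unfolding T_def by (intro sums_sum summable_sums filt(2)) auto
      ultimately show ?thesis by (rule sums_unique2)
    qed
    moreover have "(\<lambda>H. \<Sum>l<S. (\<Sum>n. ?P n s l * T l H n) * (1 + real H) powr \<beta>) \<longlonglongrightarrow>
        (\<Sum>l<S. L l * Pi $$ (s, l) * Pi $$ (r, l))"
    proof (rule tendsto_sum)
      fix l assume "l \<in> {..<S}"
      then have l: "l < S" by simp
      show "(\<lambda>H. (\<Sum>n. ?P n s l * T l H n) * (1 + real H) powr \<beta>) \<longlonglongrightarrow> L l * Pi $$ (s, l) * Pi $$ (r, l)"
        using filt(3) [OF l l l] sums_unique [OF sums_Pi [OF s l]] sums_unique [OF sums_Pi [OF r l]]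
        by (simp add: T_def)
    qed
    ultimately show ?thesis by (simp add: sum_distrib_right)
  qed

  have asymp: "(\<lambda>h::nat. covariance M (Z (int S * \<tau> + int s)) (Z (int S * \<tau> + int s + int (h * S + \<nu>)))
        / real (h + \<delta>) powr (2 * D_max - 1))
      \<longlonglongrightarrow> K * (\<Sum>i\<in>F1. Pi $$ (s - 1, i - 1) * Pi $$ (s + \<nu> - S * \<delta> - 1, i - 1) * (\<sigma> (int i))\<^sup>2)"
    if s: "s \<in> {1..S}" and \<nu>: "\<nu> \<in> {0..S - 1}" and \<delta>: "\<delta> = (if s + \<nu> \<le> S then 0 else 1)" for s \<nu> \<delta> \<tau>
  proof -
    (* The later time lies in season r, h + \<delta> periods after the earlier one. *)
    define r where "r = s + \<nu> - S * \<delta> - 1"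
    have r: "r < S" "r + 1 + S * \<delta> = s + \<nu>"
      using s \<nu> by (auto simp: r_def \<delta>)
    let ?C = "\<lambda>H. covariance M (Z (int S * \<tau> + int s)) (Z (int S * (\<tau> + int H) + int (r + 1)))"
    have "s - 1 < S" "s - 1 + 1 = s" using s by auto
    from main [OF this(1) r(1), of \<tau>, unfolded this(2)]
    have "(\<lambda>h. ?C (h + \<delta>) * (1 + real (h + \<delta>)) powr \<beta>) \<longlonglongrightarrow> (\<Sum>l<S. L l * Pi $$ (s - 1, l) * Pi $$ (r, l))"
      by (rule LIMSEQ_ignore_initial_segment)
    (* Replace the base 1 + H of the normalisation by H. *)
    moreover have "(\<lambda>h. (real (h + \<delta>) / (1 + real (h + \<delta>))) powr \<beta>) \<longlonglongrightarrow> 1 powr \<beta>"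
    proof (rule tendsto_powr [OF _ tendsto_const])
      have "(\<lambda>h. real h / (1 + real h)) \<longlonglongrightarrow> 1" by real_asymp
      then show "(\<lambda>h. real (h + \<delta>) / (1 + real (h + \<delta>))) \<longlonglongrightarrow> 1"
        by (rule LIMSEQ_ignore_initial_segment)
    qed simp
    ultimately have "(\<lambda>h. (?C (h + \<delta>) * (1 + real (h + \<delta>)) powr \<beta>) * (real (h + \<delta>) / (1 + real (h + \<delta>))) powr \<beta>)
        \<longlonglongrightarrow> (\<Sum>l<S. L l * Pi $$ (s - 1, l) * Pi $$ (r, l)) * 1 powr \<beta>"
      by (rule tendsto_mult)
    moreover have "(?C (h + \<delta>) * (1 + real (h + \<delta>)) powr \<beta>) * (real (h + \<delta>) / (1 + real (h + \<delta>))) powr \<beta> =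
        covariance M (Z (int S * \<tau> + int s)) (Z (int S * \<tau> + int s + int (h * S + \<nu>)))
        / real (h + \<delta>) powr (2 * D_max - 1)" for h
    proof -
      have "int (r + 1 + S * \<delta>) = int (s + \<nu>)" by (simp only: r(2))
      then have "int S * (\<tau> + int (h + \<delta>)) + int (r + 1) = int S * \<tau> + int s + int (h * S + \<nu>)"
        by (simp add: algebra_simps)
      moreover have "(1 + x) powr \<beta> * (x / (1 + x)) powr \<beta> = inverse (x powr (2 * D_max - 1))"
        if "x \<ge> 0" for x :: real
        using that by (simp add: powr_divide \<beta>_def powr_minus [symmetric])
      ultimately show ?thesis
        by (simp only: mult.assoc divide_inverse [of "covariance _ _ _"] of_nat_0_le_iff)
    qed
    moreover have "(\<Sum>l<S. L l * Pi $$ (s - 1, l) * Pi $$ (r, l)) =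
        K * (\<Sum>i\<in>F1. Pi $$ (s - 1, i - 1) * Pi $$ (r, i - 1) * (\<sigma> (int i))\<^sup>2)"
    proof -
      have "(\<Sum>l<S. L l * Pi $$ (s - 1, l) * Pi $$ (r, l)) =
          (\<Sum>l\<in>{l. l < S \<and> d l = D_max}. K * (Pi $$ (s - 1, l) * Pi $$ (r, l) * v l))"
        by (rule sum.mono_neutral_cong_right) (auto simp: L_def)
      also have "\<dots> = (\<Sum>i\<in>F1. K * (Pi $$ (s - 1, i - 1) * Pi $$ (r, i - 1) * (\<sigma> (int i))\<^sup>2))"
        by (rule sum.reindex_bij_witness [of _ "\<lambda>i. i - 1" "\<lambda>l. l + 1"])
          (auto simp: assms(16) d_def v_def)
      finally show ?thesis by (simp add: sum_distrib_left)
    qed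
    ultimately show ?thesis
      by (simp add: r_def)
  qed
  show ?thesis
  proof (intro conjI ballI allI impI)
    show "invertible_mat (Phi_one S p \<phi>)" by (rule Phi_one_inverse(1) [OF root Pc])
  next
    fix l i assume "l \<in> {1..S}" "i \<in> {1..S}"
    then show "(\<lambda>j. Pc j $$ (l - 1, i - 1)) sums (Pi $$ (l - 1, i - 1))"
      by (intro sums_Pi) auto
  next
    fix s \<nu> \<delta> :: nat and \<tau> :: int
    assume "s \<in> {1..S}" "\<nu> \<in> {0..S - 1}" "\<delta> = (if s + \<nu> \<le> S then 0 else 1)"
    then show "(\<lambda>h::nat. covariance M (Z (int S * \<tau> + int s)) (Z (int S * \<tau> + int s + int (h * S + \<nu>)))
                   / real (h + \<delta>) powr (2 * D_max - 1))
        \<longlonglongrightarrow> Gamma (1 - 2 * D_max) / (Gamma D_max * Gamma (1 - D_max)) *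
          (\<Sum>i\<in>F1. Pi $$ (s - 1, i - 1) * Pi $$ (s + \<nu> - S * \<delta> - 1, i - 1) * (\<sigma> (int i))\<^sup>2)"
      unfolding K_def [symmetric] by (rule asymp)
  qed
qed

end
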